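(* Let $G$ be a finite simple graph with no isolated edges and with maximum degree $\Delta > 10^{20}$. Then $G$ has an adjacent vertex distinguishing edge coloring using at most $\Delta+300$ colors; that is, the avd-chromatic number of $G$ is at most $\Delta+300$.
   Context: An isolated edge is a connected component consisting of a single edge. For a (partial) edge coloring $c$ and a vertex $v$, $S_c(v)$ denotes the set of colors appearing on the colored edges incident to $v$. An adjacent vertex distinguishing edge coloring (avd-coloring) of $G$ is a proper edge coloring $c$ such that $S_c(u)\neq S_c(v)$ for every pair of adjacent vertices $u,v$. The avd-chromatic number is the minimum number of colors in an avd-coloring. *)

theory Defs
  imports Main
begin

definition simple_graph :: "'a set \<Rightarrow> 'a set set \<Rightarrow> bool" where
  "simple_graph V E \<longleftrightarrow> finite V \<and> (\<forall>e\<in>E. e \<subseteq> V \<and> card e = 2)"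

definition incident_edges :: "'a set set \<Rightarrow> 'a \<Rightarrow> 'a set set" where
  "incident_edges E v = {e \<in> E. v \<in> e}"

definition degree :: "'a set set \<Rightarrow> 'a \<Rightarrow> nat" where
  "degree E v = card (incident_edges E v)"

definition max_degree :: "'a set \<Rightarrow> 'a set set \<Rightarrow> nat" where
  "max_degree V E = Max (insert 0 (degree E ` V))"

definition isolated_edge :: "'a set set \<Rightarrow> 'a set \<Rightarrow> bool" where
  "isolated_edge E e \<longleftrightarrow> e \<in> E \<and> (\<forall>f\<in>E. f \<inter> e \<noteq> {} \<longrightarrow> f = e)"

definition proper_edge_coloring :: "'a set set \<Rightarrow> ('a set \<Rightarrow> 'c) \<Rightarrow> bool" where
  "proper_edge_coloring E c \<longleftrightarrow>
     (\<forall>e\<in>E. \<forall>f\<in>E. e \<noteq> f \<and> e \<inter> f \<noteq> {} \<longrightarrow> c e \<noteq> c f)"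

definition color_set :: "'a set set \<Rightarrow> ('a set \<Rightarrow> 'c) \<Rightarrow> 'a \<Rightarrow> 'c set" where
  "color_set E c v = c ` incident_edges E v"

definition avd_coloring :: "'a set set \<Rightarrow> ('a set \<Rightarrow> 'c) \<Rightarrow> bool" where
  "avd_coloring E c \<longleftrightarrow> proper_edge_coloring E c \<and>
     (\<forall>u v. {u, v} \<in> E \<longrightarrow> color_set E c u \<noteq> color_set E c v)"

definition avd_colorable :: "'a set set \<Rightarrow> nat \<Rightarrow> bool" where
  "avd_colorable E k \<longleftrightarrow> (\<exists>c :: 'a set \<Rightarrow> nat. avd_coloring E c \<and> c ` E \<subseteq> {0..<k})"

definition avd_chromatic_number :: "'a set set \<Rightarrow> nat" where
  "avd_chromatic_number E = (LEAST k. avd_colorable E k)"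

end

theory Submission
  imports Defs Complex_Main "HOL-Library.FuncSet" "HOL-Combinatorics.Transposition"
begin

text \<open>Call a vertex low if its degree is at most \<open>\<Delta> / 4\<close>, and high otherwise. Start from a Vizing
  colouring with \<open>\<Delta> + 2\<close> colours, choose a sparse subgraph \<open>H\<close> and recolour its edges with new
  colours. Every high vertex has at least six edges in \<open>H\<close>, and \<open>H\<close> lies in a random set of
  edges of density about \<open>\<Delta> powr (- 3 / 4)\<close>. If adjacent high vertices \<open>u\<close>, \<open>v\<close> see the same
  colours, then each edge of \<open>H\<close> at \<open>u\<close> either has an old colour missing at \<open>v\<close>, of which there are
  only boundedly many, or has the same old colour as an edge of \<open>H\<close> at \<open>v\<close>. The local lemma excludes
  five such edges in the random set.

  An edge between low vertices can be recoloured greedily, which settles every conflict between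
  two low vertices having another low neighbour. The remaining edges between low vertices are
  contracted beforehand. Vizing's theorem for multigraphs of multiplicity two then makes the
  colours at their two ends disjoint.\<close>

subsection \<open>Edge colourings of multigraphs\<close>

text \<open>\<open>H\<close> needs bounded degree, to cost only a constant number of colours, and
  yet six edges at every high vertex. A random set of bounded expected degree fails this at a given
  vertex with constant probability, far too often for a local lemma with order \<Delta>^2 dependent
  events. So chance only supplies a set \<open>X\<close> with degrees of order \<Delta>^(1/4), and
  \<open>H\<close> is then extracted from it deterministically. Six is five plus the edge
  \<open>uv\<close> itself.

  Low vertices may have too few edges for this. Their repair must leave edges at high vertices
  alone, and recolouring an edge changes both its ends alike, so it never settles its own conflict.
  An edge between low vertices with no other such edge next to it is thus beyond repair, which is
  why it is contracted. A low and a high end have different degrees, hence different colour sets.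

  The 300 rounds up 2 + 293: two colours beyond \<Delta> for multiplicity two, and 293 = 291 + 2 for
  recolouring \<open>H\<close>, whose degrees are at most 291.\<close>

definition edges_at :: "('e \<Rightarrow> 'v set) \<Rightarrow> 'e set \<Rightarrow> 'v \<Rightarrow> 'e set" where
  "edges_at ends E w = {e \<in> E. w \<in> ends e}"

text \<open>Edges are abstract elements with an end map, so parallel edges stay distinct; sharing
  ends, they must differ in colour as well.\<close>

definition proper_on :: "('e \<Rightarrow> 'v set) \<Rightarrow> 'e set \<Rightarrow> ('e \<Rightarrow> 'c) \<Rightarrow> bool" where
  "proper_on ends E c \<longleftrightarrow> (\<forall>e\<in>E. \<forall>f\<in>E. e \<noteq> f \<longrightarrow> ends e \<inter> ends f \<noteq> {} \<longrightarrow> c e \<noteq> c f)"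

lemma finite_edges_at [simp]: "finite E \<Longrightarrow> finite (edges_at ends E w)"
  by (simp add: edges_at_def)

lemma edges_at_subset: "edges_at ends E w \<subseteq> E"
  by (auto simp: edges_at_def)

lemma proper_on_inj: "proper_on ends E c \<Longrightarrow> inj_on c (edges_at ends E w)"
  unfolding proper_on_def edges_at_def inj_on_def by blast

lemma proper_on_subset: "proper_on ends E c \<Longrightarrow> F \<subseteq> E \<Longrightarrow> proper_on ends F c"
  unfolding proper_on_def by blast

section \<open>Kempe components and connected vertex sets\<close>

lemma sum_card_edges_at:
  assumes "finite E" "finite K"
  shows "(\<Sum>w\<in>K. card (edges_at ends E w)) = (\<Sum>e\<in>E. card (ends e \<inter> K))"
proof -
  have "(\<Sum>w\<in>K. card (edges_at ends E w)) = (\<Sum>w\<in>K. \<Sum>e\<in>E. of_bool (w \<in> ends e))"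
    using assms by (intro sum.cong) (auto simp: edges_at_def Int_def)
  also have "\<dots> = (\<Sum>e\<in>E. \<Sum>w\<in>K. of_bool (w \<in> ends e))"
    by (rule sum.swap)
  also have "\<dots> = (\<Sum>e\<in>E. card (ends e \<inter> K))"
    using assms by (intro sum.cong) (auto simp: Int_def conj_commute)
  finally show ?thesis .
qed

lemma ends_eqI: "card (ends e) = 2 \<Longrightarrow> v \<in> ends e \<Longrightarrow> w \<in> ends e \<Longrightarrow> v \<noteq> w \<Longrightarrow> ends e = {v, w}"
  by (metis card_2_iff insert_iff singletonD doubleton_eq_iff)

text \<open>A spanning tree is grown vertex by vertex: while S is a proper nonempty part of
  \<open>K\<close>, some edge crosses into \<open>K - S\<close>, and adding its far end gains at
  least one inner edge.\<close>

lemma connected_edge_count: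
  assumes "finite E" "finite K" "K \<noteq> {}" "\<And>e. e \<in> E \<Longrightarrow> card (ends e) = 2"
    and conn: "\<And>S. S \<subset> K \<Longrightarrow> S \<noteq> {} \<Longrightarrow> \<exists>e\<in>E. ends e \<inter> S \<noteq> {} \<and> ends e \<inter> (K - S) \<noteq> {}"
  shows "card K \<le> card {e \<in> E. ends e \<subseteq> K} + 1"
proof -
  have "\<exists>S\<subseteq>K. card S = Suc n \<and> Suc n \<le> card {e \<in> E. ends e \<subseteq> S} + 1" if "Suc n \<le> card K" for n
    using that
  proof (induction n)
    case 0
    obtain x where "x \<in> K" using assms(3) by blast
    then show ?case by (intro exI[of _ "{x}"]) auto
  next
    case (Suc n)
    then obtain S where S: "S \<subseteq> K" "card S = Suc n" "Suc n \<le> card {e \<in> E. ends e \<subseteq> S} + 1"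
      by auto
    have "S \<subset> K" "S \<noteq> {}" using S Suc.prems by auto
    then obtain e where e: "e \<in> E" "ends e \<inter> S \<noteq> {}" "ends e \<inter> (K - S) \<noteq> {}"
      using conn by blast
    then obtain x y where xy: "x \<in> ends e" "x \<in> S" "y \<in> ends e" "y \<in> K" "y \<notin> S" by blast
    have "ends e = {x, y}" by (rule ends_eqI) (use xy e assms(4) in auto)
    then have sub: "insert e {e \<in> E. ends e \<subseteq> S} \<subseteq> {e \<in> E. ends e \<subseteq> insert y S}"
      using e xy by auto
    have "card (insert e {e \<in> E. ends e \<subseteq> S}) = Suc (card {e \<in> E. ends e \<subseteq> S})"
      using xy assms(1) by (subst card_insert_disjoint) auto
    then have "Suc (card {e \<in> E. ends e \<subseteq> S}) \<le> card {e \<in> E. ends e \<subseteq> insert y S}"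
      using card_mono[OF _ sub] assms(1) by auto
    moreover have "card (insert y S) = Suc (Suc n)"
      using S xy finite_subset[OF S(1) assms(2)] by simp
    ultimately show ?case using S xy by (intro exI[of _ "insert y S"]) auto
  qed
  from this[of "card K - 1"] obtain S where "S \<subseteq> K" "card S = card K"
      "card K \<le> card {e \<in> E. ends e \<subseteq> S} + 1"
    using assms(2,3) by (metis Suc_diff_1 card_gt_0_iff order_refl)
  then show ?thesis using card_subset_eq[OF assms(2)] by blast
qed

text \<open>Swapping \<open>i\<close> and \<open>j\<close> on a minimal union \<open>K\<close> of Kempe components in which \<open>i\<close> is designated
  more often than \<open>j\<close>. Minimality makes \<open>K\<close> connected, so it is a path or a cycle and contains at
  most two designations.\<close>

lemma kempe_exchange:
  fixes c :: "'e \<Rightarrow> 'c" and V :: "'v set"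
  assumes "finite E" "finite V" and two: "\<And>e. e \<in> E \<Longrightarrow> card (ends e) = 2"
    and V: "\<And>e. e \<in> E \<Longrightarrow> ends e \<subseteq> V"
    and proper: "proper_on ends E c" and C: "c ` E \<subseteq> C" and ij: "i \<in> C" "j \<in> C" "i \<noteq> j"
    and F: "\<And>w. w \<in> V \<Longrightarrow> F w \<subseteq> C - c ` edges_at ends E w"
    and diff: "card {w \<in> V. j \<in> F w} + 3 \<le> card {w \<in> V. i \<in> F w}"
  shows "\<exists>c' F' \<delta>. proper_on ends E c' \<and> c' ` E \<subseteq> C \<and>
    (\<forall>w\<in>V. F' w \<subseteq> C - c' ` edges_at ends E w \<and> card (F' w) = card (F w)) \<and>
    (\<forall>k. k \<noteq> i \<longrightarrow> k \<noteq> j \<longrightarrow> {w \<in> V. k \<in> F' w} = {w \<in> V. k \<in> F w}) \<and>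
    \<delta> \<in> {1, 2} \<and> card {w \<in> V. i \<in> F' w} + \<delta> = card {w \<in> V. i \<in> F w} \<and>
    card {w \<in> V. j \<in> F' w} = card {w \<in> V. j \<in> F w} + \<delta>"
proof -
  define E' where "E' = {e \<in> E. c e \<in> {i, j}}"
  define X where "X k = {w \<in> V. k \<in> F w}" for k
  \<comment> \<open>Closed sets are the unions of components of the subgraph coloured
    \<open>i\<close> or \<open>j\<close>, isolated vertices included, so no path has to be
    constructed.\<close>
  define closed where "closed K \<longleftrightarrow> K \<subseteq> V \<and> (\<forall>e\<in>E'. ends e \<inter> K \<noteq> {} \<longrightarrow> ends e \<subseteq> K)" for K
  define surplus where "surplus K = int (card (X i \<inter> K)) - int (card (X j \<inter> K))" for K
  have finX: "finite (X k)" for k using assms(2) by (simp add: X_def)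
  have XV: "X k \<inter> V = X k" for k by (auto simp: X_def)
  have "closed V \<and> surplus V > 0"
    using V diff by (auto simp: closed_def E'_def surplus_def XV) (auto simp: X_def)
  then obtain K where K: "closed K" "surplus K > 0"
    and Kmin: "\<And>K'. closed K' \<Longrightarrow> surplus K' > 0 \<Longrightarrow> card K \<le> card K'"
    using ex_has_least_nat[of "\<lambda>K. closed K \<and> surplus K > 0" V card] by metis
  have KV: "K \<subseteq> V" using K by (auto simp: closed_def)
  then have finK: "finite K" using assms(2) finite_subset by blast
  have "K \<noteq> {}" using K by (auto simp: surplus_def)
  have finE': "finite E'" using assms(1) by (simp add: E'_def)
  have conn: "\<exists>e\<in>E'. ends e \<inter> S \<noteq> {} \<and> ends e \<inter> (K - S) \<noteq> {}" if S: "S \<subset> K" "S \<noteq> {}" for S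
  proof (rule ccontr)
    assume no: "\<not> ?thesis"
    have cl: "ends e \<subseteq> K" if "e \<in> E'" "ends e \<inter> K \<noteq> {}" for e
      using that K by (auto simp: closed_def)
    have "closed S" unfolding closed_def using no S KV cl by blast
    have "closed (K - S)" unfolding closed_def using no S KV cl by blast
    have "card (X k \<inter> K) = card (X k \<inter> S) + card (X k \<inter> (K - S))" for k
      using S by (subst card_Un_disjoint[symmetric]) (auto simp: finX intro!: arg_cong[of _ _ card])
    then have "surplus K = surplus S + surplus (K - S)" by (simp add: surplus_def)
    then consider "surplus S > 0" | "surplus (K - S) > 0" using K by linarith
    then show False
    proof cases
      case 1
      then show False using Kmin[OF \<open>closed S\<close>] psubset_card_mono[OF finK S(1)] by auto
    next
      case 2
      have "card (K - S) < card K" using S finK by (intro psubset_card_mono) auto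
      then show False using Kmin[OF \<open>closed (K - S)\<close> 2] by auto
    qed
  qed
  have count: "card K \<le> card {e \<in> E'. ends e \<subseteq> K} + 1"
    by (rule connected_edge_count) (use conn finE' finK \<open>K \<noteq> {}\<close> two in \<open>auto simp: E'_def\<close>)
  \<comment> \<open>Designated colours are free at \<open>w\<close>, so each of \<open>i\<close> and
    \<open>j\<close> is spent at \<open>w\<close> at most once, by an edge or by a designation.
    Connectivity uses at least 2 (card K - 1) of these 2 card K places for edge ends, which leaves
    two for designations.\<close>
  have deg: "card (edges_at ends E' w) + of_bool (w \<in> X i) + of_bool (w \<in> X j) \<le> 2" if "w \<in> K" for w
  proof -
    have "inj_on c (edges_at ends E' w)"
      by (rule proper_on_inj, rule proper_on_subset[OF proper]) (auto simp: E'_def)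
    then have "card (edges_at ends E' w) = card (c ` edges_at ends E' w)" by (simp add: card_image)
    also have "\<dots> \<le> card ({i, j} - F w)"
    proof (rule card_mono)
      show "c ` edges_at ends E' w \<subseteq> {i, j} - F w"
        using F[of w] that KV by (force simp: edges_at_def E'_def)
    qed simp
    finally have "card (edges_at ends E' w) \<le> card ({i, j} - F w)" .
    moreover have "card ({i, j} - F w) + of_bool (w \<in> X i) + of_bool (w \<in> X j) = 2"
      using that KV ij by (auto simp: X_def insert_Diff_if)
    ultimately show ?thesis by linarith
  qed
  have cardX: "card (X k \<inter> K) = (\<Sum>w\<in>K. of_bool (w \<in> X k))" for k
    using finK by (simp add: Int_commute)
  have "2 * card {e \<in> E'. ends e \<subseteq> K} = (\<Sum>e\<in>{e \<in> E'. ends e \<subseteq> K}. card (ends e \<inter> K))"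
    using two by (auto simp: E'_def Int_absorb2 mult.commute)
  also have "\<dots> \<le> (\<Sum>e\<in>E'. card (ends e \<inter> K))"
    by (rule sum_mono2) (use finE' in auto)
  also have "\<dots> = (\<Sum>w\<in>K. card (edges_at ends E' w))"
    by (rule sum_card_edges_at[symmetric]) (use finE' finK in auto)
  finally have "2 * card {e \<in> E'. ends e \<subseteq> K} + card (X i \<inter> K) + card (X j \<inter> K)
      \<le> (\<Sum>w\<in>K. card (edges_at ends E' w) + of_bool (w \<in> X i) + of_bool (w \<in> X j))"
    by (simp add: cardX sum.distrib)
  also have "\<dots> \<le> (\<Sum>w\<in>K. 2)" by (intro sum_mono deg)
  finally have two': "card (X i \<inter> K) + card (X j \<inter> K) \<le> 2" using count by simp
  define \<tau> where "\<tau> = transpose i j"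
  define c' where "c' e = (if ends e \<inter> K \<noteq> {} then \<tau> (c e) else c e)" for e
  define F' where "F' w = (if w \<in> K then \<tau> ` F w else F w)" for w
  have \<tau>: "\<tau> x = (if x = i then j else if x = j then i else x)" for x
    by (simp add: \<tau>_def transpose_def)
  have inj\<tau>: "inj \<tau>" by (simp add: \<tau>_def)
  have c'alt: "c' e = \<tau> (c e)" if "e \<in> E" "x \<in> ends e" "x \<in> K" for e x
    using that by (auto simp: c'_def)
  have c'out: "c' e = c e" if "e \<in> E" "x \<in> ends e" "x \<notin> K" for e x
  proof (cases "c e \<in> {i, j}")
    case True
    then have "e \<in> E'" using that by (simp add: E'_def)
    then have "ends e \<inter> K = {}" using K that by (auto simp: closed_def)
    then show ?thesis by (simp add: c'_def)
  qed (auto simp: c'_def \<tau>)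
  have proper': "proper_on ends E c'"
    unfolding proper_on_def
  proof (intro ballI impI)
    fix e f assume ef: "e \<in> E" "f \<in> E" "e \<noteq> f" "ends e \<inter> ends f \<noteq> {}"
    then have ne: "c e \<noteq> c f" using proper by (simp add: proper_on_def)
    obtain x where "x \<in> ends e" "x \<in> ends f" using ef by blast
    then show "c' e \<noteq> c' f"
      using c'alt[OF ef(1)] c'alt[OF ef(2)] c'out[OF ef(1)] c'out[OF ef(2)] ne injD[OF inj\<tau>]
      by (cases "x \<in> K") metis+
  qed
  have \<tau>C: "\<tau> x \<in> C \<longleftrightarrow> x \<in> C" for x using ij by (auto simp: \<tau>)
  have c'C: "c' ` E \<subseteq> C" using C by (auto simp: c'_def \<tau>C)
  have F'C: "F' w \<subseteq> C - c' ` edges_at ends E w \<and> card (F' w) = card (F w)" if "w \<in> V" for w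
  proof (cases "w \<in> K")
    case True
    have "c' ` edges_at ends E w = \<tau> ` c ` edges_at ends E w"
      using True c'alt by (force simp: edges_at_def image_image intro!: image_cong)
    moreover have "\<tau> ` F w \<subseteq> C - \<tau> ` c ` edges_at ends E w"
      using F[OF that] injD[OF inj\<tau>] \<tau>C by blast
    moreover have "card (\<tau> ` F w) = card (F w)"
      by (intro card_image inj_on_subset[OF inj\<tau>]) simp
    ultimately show ?thesis using True by (simp add: F'_def)
  next
    case False
    have "c' ` edges_at ends E w = c ` edges_at ends E w"
      using False c'out by (force simp: edges_at_def intro!: image_cong)
    then show ?thesis using False F[OF that] by (simp add: F'_def)
  qed
  have \<tau>mem: "k \<in> \<tau> ` A \<longleftrightarrow> \<tau> k \<in> A" for k A
    using ij by (auto simp: \<tau> image_iff)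
  have other: "{w \<in> V. k \<in> F' w} = {w \<in> V. k \<in> F w}" if "k \<noteq> i" "k \<noteq> j" for k
    using that by (auto simp: F'_def \<tau>mem) (auto simp: \<tau>)
  have split: "card A = card (A - K) + card (A \<inter> K)" if "finite A" for A
    using that by (subst card_Un_disjoint[symmetric]) (auto intro!: arg_cong[of _ _ card])
  have "{w \<in> V. i \<in> F' w} = (X i - K) \<union> (X j \<inter> K)"
    using KV by (auto simp: F'_def \<tau>mem X_def) (auto simp: \<tau>)
  then have ci: "card {w \<in> V. i \<in> F' w} = card (X i - K) + card (X j \<inter> K)"
    using finX by (auto intro!: card_Un_disjoint)
  have "{w \<in> V. j \<in> F' w} = (X j - K) \<union> (X i \<inter> K)"
    using KV by (auto simp: F'_def \<tau>mem X_def) (auto simp: \<tau> split: if_splits)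
  then have cj: "card {w \<in> V. j \<in> F' w} = card (X j - K) + card (X i \<inter> K)"
    using finX by (auto intro!: card_Un_disjoint)
  define \<delta> where "\<delta> = card (X i \<inter> K) - card (X j \<inter> K)"
  have lt: "card (X j \<inter> K) < card (X i \<inter> K)" using K(2) by (simp add: surplus_def)
  have "\<delta> \<in> {1, 2}" using lt two' by (auto simp: \<delta>_def)
  moreover have "card {w \<in> V. i \<in> F' w} + \<delta> = card (X i)"
      "card {w \<in> V. j \<in> F' w} = card (X j) + \<delta>"
    using ci cj lt split[OF finX, of i] split[OF finX, of j] unfolding \<delta>_def by linarith+
  ultimately have "\<delta> \<in> {1, 2} \<and> card {w \<in> V. i \<in> F' w} + \<delta> = card {w \<in> V. i \<in> F w} \<and>
    card {w \<in> V. j \<in> F' w} = card {w \<in> V. j \<in> F w} + \<delta>"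
    unfolding X_def by blast
  then show ?thesis
    using proper' c'C F'C other by (intro exI[of _ c'] exI[of _ F'] exI[of _ \<delta>]) simp
qed

text \<open>The edges \<open>D\<close> at a new vertex \<open>v\<close> are coloured one by one, following Ehrenfeucht, Faber and
  Kierstead. Every neighbour \<open>w\<close> designates two of its free colours per edge to \<open>v\<close>, except that one
  neighbour designates one fewer. Balancing the designations by Kempe exchanges yields a colour
  \<open>i\<close> designated at a single neighbour \<open>u\<close>. It is used for an edge from \<open>v\<close> to \<open>u\<close>, and the whole
  colour class \<open>i\<close> is removed.\<close>

lemma vizing_extend:
  fixes c :: "'e \<Rightarrow> 'c"
  assumes "finite E" "finite D" "E \<inter> D = {}" and two: "\<And>e. e \<in> E \<union> D \<Longrightarrow> card (ends e) = 2"
    and D: "\<And>e. e \<in> D \<Longrightarrow> v \<in> ends e" and E: "\<And>e. e \<in> E \<Longrightarrow> v \<notin> ends e"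
    and "finite C" and proper: "proper_on ends E c" and cC: "c ` E \<subseteq> C" and "card D \<le> card C"
    and free: "\<And>w. w \<noteq> v \<Longrightarrow> 2 * card (edges_at ends D w)
                 \<le> card (C - c ` edges_at ends E w) + of_bool (w = w0)"
  shows "\<exists>c' :: 'e \<Rightarrow> 'c. proper_on ends (E \<union> D) c' \<and> c' ` (E \<union> D) \<subseteq> C"
  using assms
proof (induction "card D" arbitrary: E D C c w0)
  case 0
  then show ?case by auto
next
  case (Suc m)
  note IH = Suc.hyps(1) and m = Suc.hyps(2)
  note fin = Suc.prems(1,2) and disj = Suc.prems(3) and two = Suc.prems(4)
    and D = Suc.prems(5) and E = Suc.prems(6) and finC = Suc.prems(7)
    and proper = Suc.prems(8) and cC = Suc.prems(9) and cardD = Suc.prems(10) and free = Suc.prems(11)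
  have other: "\<exists>w. w \<noteq> v \<and> ends e = {v, w}" if "e \<in> D" for e
    using two[of e] D[OF that] that by (auto simp: card_2_iff)
  \<comment> \<open>The hypothesis allows \<open>w0\<close> one free colour less. If
    \<open>w0\<close> still has an edge to \<open>v\<close>, it must be the neighbour that
    designates one fewer; otherwise any neighbour may be chosen.\<close>
  have "\<exists>w1. w1 \<noteq> v \<and> edges_at ends D w1 \<noteq> {} \<and> (w0 \<noteq> v \<longrightarrow> edges_at ends D w0 \<noteq> {} \<longrightarrow> w1 = w0)"
  proof -
    obtain e where "e \<in> D" using m by fastforce
    with other[OF this] obtain w where "w \<noteq> v" "e \<in> edges_at ends D w"
      by (auto simp: edges_at_def)
    then show ?thesis by (cases "w0 \<noteq> v \<and> edges_at ends D w0 \<noteq> {}") blast+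
  qed
  then obtain w1 where w1: "w1 \<noteq> v" "edges_at ends D w1 \<noteq> {}"
    and w10: "w0 \<noteq> v \<Longrightarrow> edges_at ends D w0 \<noteq> {} \<Longrightarrow> w1 = w0" by blast
  define s where "s w = (if w = v then 0 else 2 * card (edges_at ends D w) - of_bool (w = w1))" for w
  define V where "V = (\<Union>e\<in>E \<union> D. ends e)"
  have "finite (ends e)" if "e \<in> E \<union> D" for e using two[OF that] by (intro card_ge_0_finite) auto
  then have finV: "finite V" using fin by (auto simp: V_def)
  have pos1: "card (edges_at ends D w1) > 0" using w1 fin by (simp add: card_gt_0_iff)
  have w1V: "w1 \<in> V" using w1 by (auto simp: V_def edges_at_def)
  define valid where "valid c F \<longleftrightarrow> proper_on ends E c \<and> c ` E \<subseteq> C \<and>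
      (\<forall>w\<in>V. F w \<subseteq> C - c ` edges_at ends E w \<and> card (F w) = s w)"
    for c :: "'e \<Rightarrow> 'c" and F
  define X where "X F i = {w \<in> V. i \<in> F w}" for F :: "'a \<Rightarrow> 'c set" and i
  have finX: "finite (X F i)" for F i using finV by (simp add: X_def)
  \<comment> \<open>Minimising this sum of squares balances the designations: moving one or two of
    them from \<open>i\<close> to \<open>j\<close> lowers it as soon as the counts differ by at
    least three.\<close>
  define \<Phi> where "\<Phi> F = (\<Sum>i\<in>C. (card (X F i))\<^sup>2)" for F
  have "\<exists>F. valid c F"
  proof -
    have "\<exists>A. A \<subseteq> C - c ` edges_at ends E w \<and> card A = s w" for w
    proof -
      have "s w \<le> card (C - c ` edges_at ends E w)"
        using free[of w] w10 unfolding s_def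
        by (cases "w = w0"; cases "edges_at ends D w = {}") auto
      then show ?thesis by (metis obtain_subset_with_card_n)
    qed
    then obtain F where "\<And>w. F w \<subseteq> C - c ` edges_at ends E w \<and> card (F w) = s w" by metis
    then show ?thesis using proper cC unfolding valid_def by blast
  qed
  then obtain c F where cF: "valid c F" and min: "\<And>c' F'. valid c' F' \<Longrightarrow> \<Phi> F \<le> \<Phi> F'"
    using ex_has_least_nat[of "\<lambda>p. valid (fst p) (snd p)" _ "\<lambda>p. \<Phi> (snd p)"] by auto metis
  have cFD: "proper_on ends E c" "c ` E \<subseteq> C"
    "\<And>w. w \<in> V \<Longrightarrow> F w \<subseteq> C - c ` edges_at ends E w" "\<And>w. w \<in> V \<Longrightarrow> card (F w) = s w"
    using cF by (auto simp: valid_def)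
  have balanced: "card (X F i) \<le> card (X F j) + 2" if ij: "i \<in> C" "j \<in> C" for i j
  proof (rule ccontr)
    assume "\<not> ?thesis"
    then have big: "card {w \<in> V. j \<in> F w} + 3 \<le> card {w \<in> V. i \<in> F w}" and "i \<noteq> j"
      by (auto simp: X_def)
    have "\<exists>c' F' \<delta>. proper_on ends E c' \<and> c' ` E \<subseteq> C \<and>
      (\<forall>w\<in>V. F' w \<subseteq> C - c' ` edges_at ends E w \<and> card (F' w) = card (F w)) \<and>
      (\<forall>k. k \<noteq> i \<longrightarrow> k \<noteq> j \<longrightarrow> {w \<in> V. k \<in> F' w} = {w \<in> V. k \<in> F w}) \<and>
      \<delta> \<in> {1, 2} \<and> card {w \<in> V. i \<in> F' w} + \<delta> = card {w \<in> V. i \<in> F w} \<and>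
      card {w \<in> V. j \<in> F' w} = card {w \<in> V. j \<in> F w} + \<delta>"
      by (rule kempe_exchange[OF fin(1) finV _ _ cFD(1,2) ij \<open>i \<noteq> j\<close> cFD(3) big])
        (use two in \<open>auto simp: V_def\<close>)
    then obtain c' F' \<delta> where new: "proper_on ends E c'" "c' ` E \<subseteq> C"
      "\<forall>w\<in>V. F' w \<subseteq> C - c' ` edges_at ends E w \<and> card (F' w) = card (F w)"
      "\<forall>k. k \<noteq> i \<longrightarrow> k \<noteq> j \<longrightarrow> {w \<in> V. k \<in> F' w} = {w \<in> V. k \<in> F w}"
      and \<delta>: "\<delta> \<in> {1::nat, 2}" "card {w \<in> V. i \<in> F' w} + \<delta> = card {w \<in> V. i \<in> F w}"
      "card {w \<in> V. j \<in> F' w} = card {w \<in> V. j \<in> F w} + \<delta>"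
      by (elim exE conjE)
    have "valid c' F'" using new cFD(4) by (auto simp: valid_def)
    then have le: "\<Phi> F \<le> \<Phi> F'" by (rule min)
    have split: "\<Phi> G = (card (X G i))\<^sup>2 + ((card (X G j))\<^sup>2 + (\<Sum>k\<in>C - {i} - {j}. (card (X G k))\<^sup>2))" for G
      unfolding \<Phi>_def using finC ij \<open>i \<noteq> j\<close>
      by (subst sum.remove[of C i], simp, simp, subst sum.remove[of "C - {i}" j]) auto
    have "(\<Sum>k\<in>C - {i} - {j}. (card (X F' k))\<^sup>2) = (\<Sum>k\<in>C - {i} - {j}. (card (X F k))\<^sup>2)"
      using new(4) by (intro sum.cong) (auto simp: X_def)
    then have "(card (X F i))\<^sup>2 + (card (X F j))\<^sup>2 \<le> (card (X F' i))\<^sup>2 + (card (X F' j))\<^sup>2"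
      using le by (simp add: split)
    moreover obtain a b where ab: "card (X F' i) = a" "card (X F j) = b" by blast
    ultimately have "(a + \<delta>)\<^sup>2 + b\<^sup>2 \<le> a\<^sup>2 + (b + \<delta>)\<^sup>2" "b + 3 \<le> a + \<delta>"
      using \<delta> big by (simp_all add: X_def)
    then show False using \<delta>(1) by (auto simp: power2_eq_square algebra_simps)
  qed
  have "(\<Sum>i\<in>C. card (X F i)) = (\<Sum>w\<in>V. card (F w))"
  proof -
    have "(\<Sum>i\<in>C. card (X F i)) = (\<Sum>i\<in>C. \<Sum>w\<in>V. of_bool (i \<in> F w))"
      using finV by (intro sum.cong) (auto simp: X_def Int_def)
    also have "\<dots> = (\<Sum>w\<in>V. \<Sum>i\<in>C. of_bool (i \<in> F w))" by (rule sum.swap)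
    also have "\<dots> = (\<Sum>w\<in>V. card (F w))"
    proof (rule sum.cong)
      fix w assume "w \<in> V"
      then have "C \<inter> F w = F w" using cFD(3) by blast
      then show "(\<Sum>i\<in>C. of_bool (i \<in> F w)) = card (F w)" using finC by simp
    qed simp
    finally show ?thesis .
  qed
  also have "\<dots> = (\<Sum>w\<in>V. s w)" using cFD(4) by simp
  also have "\<dots> + 1 = 2 * card D"
  proof -
    have "(\<Sum>w\<in>V. s w) + 1 = (\<Sum>w\<in>V - {v}. s w) + 1"
      using finV by (subst sum.mono_neutral_right[of V "V - {v}"]) (auto simp: s_def)
    also have "\<dots> = (\<Sum>w\<in>V - {v} - {w1}. s w) + (s w1 + 1)"
      using finV w1V w1 by (subst sum.remove[of "V - {v}" w1]) auto
    also have "s w1 + 1 = 2 * card (edges_at ends D w1)" using w1 pos1 by (simp add: s_def)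
    also have "(\<Sum>w\<in>V - {v} - {w1}. s w) = (\<Sum>w\<in>V - {v} - {w1}. 2 * card (edges_at ends D w))"
      by (rule sum.cong) (auto simp: s_def)
    also have "\<dots> + 2 * card (edges_at ends D w1) = (\<Sum>w\<in>V - {v}. 2 * card (edges_at ends D w))"
      using finV w1V w1 by (subst sum.remove[of "V - {v}" w1]) auto
    also have "\<dots> = 2 * (\<Sum>w\<in>V - {v}. card (edges_at ends D w))" by (simp add: sum_distrib_left)
    also have "(\<Sum>w\<in>V - {v}. card (edges_at ends D w)) = (\<Sum>e\<in>D. card (ends e \<inter> (V - {v})))"
      using finV fin by (intro sum_card_edges_at) auto
    also have "\<dots> = (\<Sum>e\<in>D. 1)"
    proof (rule sum.cong)
      fix e assume e: "e \<in> D"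
      with other obtain w where w: "w \<noteq> v" "ends e = {v, w}" by blast
      then have "ends e \<inter> (V - {v}) = {w}" using e by (auto simp: V_def)
      then show "card (ends e \<inter> (V - {v})) = 1" by simp
    qed simp
    finally show ?thesis by simp
  qed
  finally have total: "(\<Sum>i\<in>C. card (X F i)) + 1 = 2 * card D" by simp
  \<comment> \<open>The total 2 card D - 1 is odd because of \<open>w1\<close>, and the average is
    below two. So some count is at most one; if it is zero, balance bounds all counts by two, and
    without a one they would all be even.\<close>
  have "\<exists>i\<in>C. card (X F i) = 1"
  proof (rule ccontr)
    assume no: "\<not> ?thesis"
    have "(\<Sum>i\<in>C. card (X F i)) < (\<Sum>i\<in>C. 2)" using total cardD by simp
    then obtain j where j: "j \<in> C" "card (X F j) < 2" by (meson leI sum_mono leD)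
    then have "card (X F j) = 0" using no by force
    then have "card (X F i) \<in> {0, 2}" if "i \<in> C" for i
      using balanced[OF that j(1)] no that by force
    then have "even (\<Sum>i\<in>C. card (X F i))" by (intro dvd_sum) fastforce
    then show False using total by presburger
  qed
  then obtain i u where i: "i \<in> C" "X F i = {u}" by (auto simp: card_1_singleton_iff)
  then have u: "u \<in> V" "i \<in> F u" by (auto simp: X_def)
  have finF: "finite (F w)" if "w \<in> V" for w
    using cFD(3)[OF that] finC by (meson Diff_subset finite_subset)
  have "s u \<noteq> 0" using cFD(4)[OF u(1)] finF[OF u(1)] u(2) by (metis card_eq_0_iff empty_iff)
  then have "u \<noteq> v" and "edges_at ends D u \<noteq> {}" by (auto simp: s_def split: if_splits)
  then obtain e where e: "e \<in> D" "u \<in> ends e" by (auto simp: edges_at_def)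
  have ends_e: "ends e = {v, u}"
    using two[of e] D[OF e(1)] e \<open>u \<noteq> v\<close> by (intro ends_eqI) auto
  define M where "M = {f \<in> E. c f = i}"
  have uM: "u \<notin> ends f" if "f \<in> M" for f
    using cFD(3)[OF u(1)] u(2) that unfolding M_def edges_at_def by blast
  \<comment> \<open>The colour \<open>i\<close> leaves together with its class and \<open>e\<close>,
    and \<open>w1\<close> becomes the exempt vertex. Only \<open>u\<close> loses a designation, but
    its demand drops by two.\<close>
  have "\<exists>c'. proper_on ends ((E - M) \<union> (D - {e})) c' \<and> c' ` ((E - M) \<union> (D - {e})) \<subseteq> C - {i}"
  proof (rule IH[of "D - {e}" "E - M" "C - {i}" c w1])
    show "m = card (D - {e})" using m e fin by simp
    show "proper_on ends (E - M) c" using cFD(1) proper_on_subset by blast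
    show "c ` (E - M) \<subseteq> C - {i}" using cFD(2) by (auto simp: M_def)
    show "card (D - {e}) \<le> card (C - {i})" using cardD e i fin finC by simp
    show "2 * card (edges_at ends (D - {e}) w)
        \<le> card (C - {i} - c ` edges_at ends (E - M) w) + of_bool (w = w1)" if "w \<noteq> v" for w
    proof (cases "w \<in> V")
      case False
      then have "edges_at ends (D - {e}) w = {}" by (auto simp: edges_at_def V_def)
      then show ?thesis by simp
    next
      case True
      have "F w - {i} \<subseteq> C - {i} - c ` edges_at ends (E - M) w"
        using cFD(3)[OF True] by (auto simp: edges_at_def)
      then have le: "card (F w - {i}) \<le> card (C - {i} - c ` edges_at ends (E - M) w)"
        using finC by (intro card_mono) auto
      show ?thesis
      proof (cases "w = u")
        case True
        have "edges_at ends (D - {e}) u = edges_at ends D u - {e}" by (auto simp: edges_at_def)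
        then have "card (edges_at ends (D - {e}) u) = card (edges_at ends D u) - 1"
          using e fin by (auto simp: edges_at_def)
        moreover have "card (F u - {i}) = s u - 1" using u cFD(4) finF by simp
        ultimately show ?thesis using le True \<open>u \<noteq> v\<close> by (auto simp: s_def)
      next
        case False
        then have "i \<notin> F w" using True i by (auto simp: X_def)
        then have "card (F w - {i}) = s w" using True cFD(4) by simp
        moreover have "edges_at ends (D - {e}) w = edges_at ends D w"
          using False that ends_e by (auto simp: edges_at_def)
        ultimately show ?thesis using le that by (auto simp: s_def)
      qed
    qed
  qed (use fin disj two D E finC in auto)
  then obtain c' where c': "proper_on ends ((E - M) \<union> (D - {e})) c'"
    "c' ` ((E - M) \<union> (D - {e})) \<subseteq> C - {i}" by blast
  define c'' where "c'' f = (if f \<in> insert e M then i else c' f)" for f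
  have "c'' ` (E \<union> D) \<subseteq> C" using c'(2) i by (auto simp: c''_def)
  moreover have "proper_on ends (E \<union> D) c''"
    unfolding proper_on_def
  proof (intro ballI impI)
    fix f g assume fg: "f \<in> E \<union> D" "g \<in> E \<union> D" "f \<noteq> g" "ends f \<inter> ends g \<noteq> {}"
    have sep: "ends f' \<inter> ends g' = {}" if "f' \<in> insert e M" "g' \<in> insert e M" "f' \<noteq> g'" for f' g'
    proof -
      have "ends e \<inter> ends h = {}" if "h \<in> M" for h
        using that uM E ends_e by (auto simp: M_def)
      moreover have "ends h \<inter> ends h' = {}" if "h \<in> M" "h' \<in> M" "h \<noteq> h'" for h h'
        using that cFD(1)[unfolded proper_on_def, rule_format, of h h'] by (auto simp: M_def)
      ultimately show ?thesis using that by (elim insertE) (simp_all add: Int_commute[of "ends e"])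
    qed
    have c'i: "c' h \<noteq> i" if "h \<in> E \<union> D" "h \<notin> insert e M" for h
      using c'(2) that by blast
    show "c'' f \<noteq> c'' g"
    proof (cases "f \<in> insert e M"; cases "g \<in> insert e M")
      assume "f \<notin> insert e M" "g \<notin> insert e M"
      then show ?thesis using c'(1) fg unfolding c''_def proper_on_def by auto
    qed (use sep fg c'i in \<open>auto simp: c''_def\<close>)
  qed
  ultimately show ?case by blast
qed

section \<open>Vizing's theorem for multigraphs\<close>

text \<open>Vertices are added one at a time. If m edges join the new vertex to \<open>w\<close>, at
  most d - m colours are used at \<open>w\<close> so far, which leaves at least \<mu> + m \<ge> 2 m
  free.\<close>

lemma vizing_multigraph:
  assumes "finite E" and two: "\<And>e. e \<in> E \<Longrightarrow> card (ends e) = 2"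
    and deg: "\<And>w. card (edges_at ends E w) \<le> d"
    and mult: "\<And>v w. v \<noteq> w \<Longrightarrow> card {e \<in> E. ends e = {v, w}} \<le> \<mu>"
    and "finite C" "d + \<mu> \<le> card C"
  shows "\<exists>c :: 'e \<Rightarrow> 'c. proper_on ends E c \<and> c ` E \<subseteq> (C :: 'c set)"
proof -
  have "\<exists>c. proper_on ends {e \<in> E. ends e \<subseteq> U} c \<and> c ` {e \<in> E. ends e \<subseteq> U} \<subseteq> C" if "finite U" for U
    using that
  proof (induction U)
    case empty
    have no: "{e \<in> E. ends e \<subseteq> {}} = {}" using two by fastforce
    show ?case unfolding no by (simp add: proper_on_def)
  next
    case (insert v U)
    let ?E = "{e \<in> E. ends e \<subseteq> U}" and ?D = "{e \<in> E. ends e \<subseteq> insert v U \<and> v \<in> ends e}"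
    obtain c where c: "proper_on ends ?E c" "c ` ?E \<subseteq> C" using insert.IH by blast
    have "card ?D \<le> card (edges_at ends E v)"
      using assms(1) by (intro card_mono) (auto simp: edges_at_def)
    then have "card ?D \<le> card C" using deg[of v] assms(6) by linarith
    \<comment> \<open>With \<open>v\<close> itself as exempt vertex, every neighbour has to meet the
      full demand.\<close>
    moreover have "2 * card (edges_at ends ?D w)
        \<le> card (C - c ` edges_at ends ?E w) + of_bool (w = v)" if "w \<noteq> v" for w
    proof -
      have "edges_at ends ?D w \<subseteq> {e \<in> E. ends e = {v, w}}"
        using ends_eqI[of ends _ v w] two that by (auto simp: edges_at_def)
      then have "card (edges_at ends ?D w) \<le> card {e \<in> E. ends e = {v, w}}"
        using assms(1) by (intro card_mono) auto
      then have m: "card (edges_at ends ?D w) \<le> \<mu>" using mult[of v w] that by auto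
      have "card (edges_at ends ?D w) + card (edges_at ends ?E w)
          = card (edges_at ends ?D w \<union> edges_at ends ?E w)"
        using insert.hyps assms(1) by (intro card_Un_disjoint[symmetric]) (auto simp: edges_at_def)
      also have "\<dots> \<le> card (edges_at ends E w)"
        using assms(1) by (intro card_mono) (auto simp: edges_at_def)
      also have "\<dots> \<le> d" by (rule deg)
      finally have s: "card (edges_at ends ?D w) + card (edges_at ends ?E w) \<le> d" .
      have "card C - card (c ` edges_at ends ?E w) \<le> card (C - c ` edges_at ends ?E w)"
        using assms(1) by (intro diff_card_le_card_Diff) auto
      moreover have "card (c ` edges_at ends ?E w) \<le> card (edges_at ends ?E w)"
        using assms(1) by (intro card_image_le) auto
      ultimately show ?thesis using m s assms(6) by linarith
    qed
    ultimately have "\<exists>c'. proper_on ends (?E \<union> ?D) c' \<and> c' ` (?E \<union> ?D) \<subseteq> C"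
      using assms(1,5) two c insert.hyps
      by (intro vizing_extend[of ?E ?D ends v C c v]) auto
    moreover have "?E \<union> ?D = {e \<in> E. ends e \<subseteq> insert v U}" by blast
    ultimately show ?case by simp
  qed
  moreover have "finite (\<Union>e\<in>E. ends e)"
    using assms(1) two by (intro finite_UN_I) (auto intro: card_ge_0_finite)
  ultimately have "\<exists>c. proper_on ends {e \<in> E. ends e \<subseteq> (\<Union>e\<in>E. ends e)} c \<and>
      c ` {e \<in> E. ends e \<subseteq> (\<Union>e\<in>E. ends e)} \<subseteq> C" by blast
  moreover have "{e \<in> E. ends e \<subseteq> (\<Union>e\<in>E. ends e)} = E" by blast
  ultimately show ?thesis by simp
qed


text \<open>Split every vertex \<open>w\<close> into vertices \<open>(w, j)\<close> of degree \<open>q\<close>, and a last one of smaller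
  degree. In a colouring of the split graph with \<open>q + 2\<close> colours a vertex of degree \<open>q\<close> misses
  only two colours, so the union of any three colour classes covers it.\<close>

lemma sparse_subgraph:
  assumes "finite X" and two: "\<And>e. e \<in> X \<Longrightarrow> card (ends e) = 2"
    and mult: "\<And>v w. v \<noteq> w \<Longrightarrow> card {e \<in> X. ends e = {v, w}} \<le> 2"
    and "0 < q" and deg: "\<And>w. card (edges_at ends X w) \<le> M"
  shows "\<exists>H\<subseteq>X. \<forall>w. card (edges_at ends X w) div q \<le> card (edges_at ends H w) \<and>
    card (edges_at ends H w) \<le> 3 * (M div q + 1)"
proof -
  have "\<exists>f. bij_betw f (edges_at ends X w) {0..<card (edges_at ends X w)}" for w
    using assms(1) by (intro ex_bij_betw_finite_nat) simp
  then obtain num where num: "\<And>w. bij_betw (num w) (edges_at ends X w) {0..<card (edges_at ends X w)}"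
    by metis
  \<comment> \<open>The edges at \<open>w\<close> are numbered and dealt out to the copies of
    \<open>w\<close> in blocks of \<open>q\<close> consecutive numbers, independently at the two
    ends of an edge.\<close>
  define ends' where "ends' e = (\<lambda>w. (w, num w e div q)) ` ends e" for e
  have fst_ends': "fst ` ends' e = ends e" for e by (force simp: ends'_def)
  have at': "edges_at ends' X (w, j) = {e \<in> edges_at ends X w. num w e div q = j}" for w j
    by (auto simp: edges_at_def ends'_def)
  have inj: "inj_on (num w) (edges_at ends X w)" for w using num by (simp add: bij_betw_def)
  have block: "{n. n div q = j} = {j * q..<j * q + q}" for j
  proof -
    have "n div q = j \<longleftrightarrow> j * q \<le> n \<and> n < j * q + q" for n
    proof
      assume "n div q = j"
      then show "j * q \<le> n \<and> n < j * q + q"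
        using \<open>0 < q\<close> dividend_less_div_times[of q n] by (auto simp: add.commute)
    qed (auto intro!: div_nat_eqI simp: mult.commute)
    then show ?thesis by (intro set_eqI) (simp only: mem_Collect_eq atLeastLessThan_iff)
  qed
  have "\<exists>h :: _ \<Rightarrow> nat. proper_on ends' X h \<and> h ` X \<subseteq> {..<q + 2}"
  proof (rule vizing_multigraph[where d = q and \<mu> = 2])
    show "card (ends' e) = 2" if "e \<in> X" for e
      using two[OF that] unfolding ends'_def by (subst card_image) (auto intro: inj_onI)
    show "card (edges_at ends' X w) \<le> q" for w
    proof (cases w)
      case (Pair w j)
      have "card (edges_at ends' X (w, j)) = card (num w ` edges_at ends' X (w, j))"
        using inj_on_subset[OF inj[of w]] by (intro card_image[symmetric]) (auto simp: at')
      also have "\<dots> \<le> card {n. n div q = j}"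
        by (intro card_mono, simp add: block, auto simp: at')
      finally show ?thesis using Pair by (simp add: block)
    qed
    show "card {e \<in> X. ends' e = {v, w}} \<le> 2" if "v \<noteq> w" for v w
    proof -
      have sub: "{e \<in> X. ends' e = {v, w}} \<subseteq> {e \<in> X. ends e = {fst v, fst w}}"
      proof
        fix e assume e: "e \<in> {e \<in> X. ends' e = {v, w}}"
        then have "ends e = fst ` {v, w}" using fst_ends'[of e] by simp
        then show "e \<in> {e \<in> X. ends e = {fst v, fst w}}" using e by simp
      qed
      show ?thesis
      proof (cases "fst v = fst w")
        case True
        have "{e \<in> X. ends e = {fst v, fst w}} = {}" using two True by fastforce
        then have "{e \<in> X. ends' e = {v, w}} = {}" using sub by blast
        then show ?thesis by (simp only: card.empty)
      next
        case False
        then show ?thesis using card_mono[OF _ sub] mult[OF False] assms(1) by auto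
      qed
    qed
  qed (use assms(1) in auto)
  then obtain h :: "_ \<Rightarrow> nat" where h: "proper_on ends' X h" "h ` X \<subseteq> {..<q + 2}" by blast
  define H where "H = {e \<in> X. h e < 3}"
  have lower: "card (edges_at ends X w) div q \<le> card (edges_at ends H w)" for w
  proof -
    have "\<exists>e\<in>edges_at ends H w. num w e div q = j" if j: "j < card (edges_at ends X w) div q" for j
    proof (rule ccontr)
      assume none: "\<not> ?thesis"
      let ?B = "edges_at ends' X (w, j)"
      have "(j + 1) * q \<le> card (edges_at ends X w) div q * q"
        using j by (intro mult_right_mono) auto
      also have "\<dots> \<le> card (edges_at ends X w)" by simp
      finally have "j * q + q \<le> card (edges_at ends X w)" by simp
      then have "{j * q..<j * q + q} \<subseteq> num w ` edges_at ends X w"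
        using num[of w] by (auto simp: bij_betw_def)
      then have "{j * q..<j * q + q} \<subseteq> num w ` ?B"
        by (auto simp: at' block[symmetric] image_iff)
      then have "card {j * q..<j * q + q} \<le> card ?B"
        using assms(1) by (intro surj_card_le) auto
      moreover have "card ?B = card (h ` ?B)"
        using proper_on_inj[OF h(1)] by (simp add: card_image)
      moreover have "3 \<le> h e \<and> h e < q + 2" if "e \<in> ?B" for e
      proof -
        have "e \<in> edges_at ends X w" "num w e div q = j" using that by (auto simp: at')
        then show ?thesis using none h(2) by (force simp: H_def edges_at_def)
      qed
      then have "h ` ?B \<subseteq> {3..<q + 2}" by auto
      then have "card (h ` ?B) \<le> q - 1" using card_mono[of "{3..<q + 2}" "h ` ?B"] by simp
      ultimately show False using \<open>0 < q\<close> by simp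
    qed
    then have "{..<card (edges_at ends X w) div q} \<subseteq> (\<lambda>e. num w e div q) ` edges_at ends H w"
      by (auto simp: image_iff)
    then have "card {..<card (edges_at ends X w) div q} \<le> card (edges_at ends H w)"
      using assms(1) by (intro surj_card_le) (auto simp: H_def)
    then show ?thesis by simp
  qed
  have upper: "card (edges_at ends H w) \<le> 3 * (M div q + 1)" for w
  proof -
    have sub: "edges_at ends H w \<subseteq> edges_at ends X w" by (auto simp: edges_at_def H_def)
    \<comment> \<open>An edge of \<open>H\<close> at \<open>w\<close> is determined by the copy of
      \<open>w\<close> it uses and by its colour: at most \<open>M div q + 1\<close> copies with
      three colours each.\<close>
    have "inj_on (\<lambda>e. (num w e div q, h e)) (edges_at ends H w)"
    proof (rule inj_onI)
      fix e f assume *: "e \<in> edges_at ends H w" "f \<in> edges_at ends H w"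
        "(num w e div q, h e) = (num w f div q, h f)"
      then have "e \<in> edges_at ends' X (w, num w e div q)" "f \<in> edges_at ends' X (w, num w e div q)"
        using sub by (auto simp: at')
      then show "e = f" using proper_on_inj[OF h(1)] * by (auto dest: inj_onD)
    qed
    moreover have "(\<lambda>e. (num w e div q, h e)) ` edges_at ends H w \<subseteq> {..M div q} \<times> {..<3}"
    proof safe
      fix e assume e: "e \<in> edges_at ends H w"
      then have "num w e < card (edges_at ends X w)"
        using bij_betwE[OF num[of w]] sub by auto
      then show "num w e div q \<le> M div q" using deg[of w] by (intro div_le_mono) linarith
      show "h e < 3" using e by (auto simp: edges_at_def H_def)
    qed
    ultimately have "card (edges_at ends H w) \<le> card ({..M div q} \<times> {..<3::nat})"
      by (intro card_inj_on_le) auto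
    then show ?thesis by simp
  qed
  show ?thesis using lower upper by (intro exI[of _ H]) (auto simp: H_def)
qed

subsection \<open>The local lemma\<close>

text \<open>The event \<open>A\<close> depends only on the coordinates in \<open>T\<close>.
  Probability is counting in a finite product, so independence becomes a product formula for
  cardinalities.\<close>

definition determined_by :: "'i set \<Rightarrow> ('i \<Rightarrow> 'a) set \<Rightarrow> ('i \<Rightarrow> 'a) set \<Rightarrow> bool" where
  "determined_by T \<Omega> A \<longleftrightarrow> A \<subseteq> \<Omega> \<and> (\<forall>\<omega>\<in>A. \<forall>\<omega>'\<in>\<Omega>. (\<forall>e\<in>T. \<omega> e = \<omega>' e) \<longrightarrow> \<omega>' \<in> A)"

lemma determined_byD:
  "determined_by T \<Omega> A \<Longrightarrow> \<omega> \<in> A \<Longrightarrow> \<omega>' \<in> \<Omega> \<Longrightarrow> (\<And>e. e \<in> T \<Longrightarrow> \<omega> e = \<omega>' e) \<Longrightarrow> \<omega>' \<in> A"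
  by (auto simp: determined_by_def)

text \<open>Exchanging the coordinates in \<open>T\<close> of two points maps \<open>(A \<inter> B) \<times> \<Omega>\<close> bijectively to \<open>A \<times> B\<close>.\<close>

lemma card_Int_determined:
  assumes "A = Pi\<^sub>E I S" and "determined_by T A B" "determined_by (I - T) A C"
  shows "card (B \<inter> C) * card A = card B * card C"
proof -
  define mix where "mix x y e = (if e \<in> T then x e else y e)" for x y :: "'a \<Rightarrow> 'b" and e
  define f where "f p = (mix (fst p) (snd p), mix (snd p) (fst p))" for p
  have mixA: "mix x y \<in> A" if "x \<in> A" "y \<in> A" for x y
    using that unfolding assms(1) mix_def by (intro PiE_I) (auto simp: PiE_def Pi_def extensional_def)
  have sub: "B \<subseteq> A" "C \<subseteq> A" using assms(2,3) by (auto simp: determined_by_def)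
  have ff: "f (f p) = p" for p by (cases p) (auto simp: f_def mix_def fun_eq_iff)
  have "bij_betw f ((B \<inter> C) \<times> A) (B \<times> C)"
  proof (rule bij_betw_byWitness[where f' = f])
    show "f ` ((B \<inter> C) \<times> A) \<subseteq> B \<times> C"
    proof (rule image_subsetI)
      fix p assume "p \<in> (B \<inter> C) \<times> A"
      then obtain x y where p: "p = (x, y)" and xy: "x \<in> B" "x \<in> C" "x \<in> A" "y \<in> A"
        using sub by auto
      have "mix x y \<in> B"
        by (rule determined_byD[OF assms(2) xy(1)]) (use xy mixA in \<open>auto simp: mix_def\<close>)
      moreover have "mix y x \<in> C"
        by (rule determined_byD[OF assms(3) xy(2)]) (use xy mixA in \<open>auto simp: mix_def\<close>)
      ultimately show "f p \<in> B \<times> C" by (simp add: f_def p)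
    qed
    show "f ` (B \<times> C) \<subseteq> (B \<inter> C) \<times> A"
    proof (rule image_subsetI)
      fix p assume "p \<in> B \<times> C"
      then obtain x y where p: "p = (x, y)" and xy: "x \<in> B" "y \<in> C" "x \<in> A" "y \<in> A"
        using sub by auto
      have "mix x y \<in> B"
        by (rule determined_byD[OF assms(2) xy(1)]) (use xy mixA in \<open>auto simp: mix_def\<close>)
      moreover have "mix x y \<in> C"
        by (rule determined_byD[OF assms(3) xy(2)]) (use xy mixA in \<open>auto simp: mix_def\<close>)
      ultimately show "f p \<in> (B \<inter> C) \<times> A" using xy mixA by (simp add: f_def p)
    qed
  qed (auto simp: ff)
  then have "card ((B \<inter> C) \<times> A) = card (B \<times> C)" by (rule bij_betw_same_card)
  then show ?thesis by (simp add: card_cartesian_product)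
qed

text \<open>Events are related if they share a coordinate, so each has at most a * b related ones.
  Induction on \<open>S\<close> bounds the conditional probability of \<open>A j\<close> given
  \<open>G S\<close> by 2 p: independence of the unrelated events gives p, and avoiding the related
  ones costs a factor two, as they cover at most a * b * 2 p \<le> 1/2 of
  \<open>G S2\<close>.\<close>

lemma lovasz_local_lemma:
  fixes A :: "'j \<Rightarrow> ('i \<Rightarrow> 'a) set" and p :: real
  assumes \<Omega>: "\<Omega> = Pi\<^sub>E I S" "finite \<Omega>" "\<Omega> \<noteq> {}" and fin: "finite I" "finite J"
    and det: "\<And>j. j \<in> J \<Longrightarrow> determined_by (T j) \<Omega> (A j)" and T: "\<And>j. j \<in> J \<Longrightarrow> T j \<subseteq> I"
    and cardT: "\<And>j. j \<in> J \<Longrightarrow> card (T j) \<le> a" and cardJ: "\<And>i. i \<in> I \<Longrightarrow> card {j \<in> J. i \<in> T j} \<le> b"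
    and p: "\<And>j. j \<in> J \<Longrightarrow> real (card (A j)) \<le> p * card \<Omega>"
    and small: "0 \<le> p" "4 * p * a * b \<le> 1" "2 * p < 1"
  shows "\<exists>\<omega>\<in>\<Omega>. \<forall>j\<in>J. \<omega> \<notin> A j"
proof -
  define G where "G S = \<Omega> - (\<Union>j\<in>S. A j)" for S
  have finG: "finite (G S)" for S using \<Omega>(2) by (simp add: G_def)
  have AO: "A j \<subseteq> \<Omega>" if "j \<in> J" for j using det[OF that] by (simp add: determined_by_def)
  then have finA: "finite (A j)" if "j \<in> J" for j using that \<Omega>(2) finite_subset by blast
  have key: "real (card (A j \<inter> G S)) \<le> 2 * p * card (G S)" if "j \<in> J" "S \<subseteq> J" for j S
    using that
  proof (induction "card S" arbitrary: S j rule: less_induct)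
    case less
    have finS: "finite S" using less.prems(2) fin(2) finite_subset by blast
    define S1 where "S1 = {k \<in> S. T k \<inter> T j \<noteq> {}}"
    define S2 where "S2 = S - S1"
    have "S1 \<subseteq> (\<Union>i\<in>T j. {k \<in> J. i \<in> T k})" using less.prems by (auto simp: S1_def)
    then have "card S1 \<le> card (\<Union>i\<in>T j. {k \<in> J. i \<in> T k})"
      using T[OF less.prems(1)] fin by (intro card_mono) (auto intro: finite_subset)
    also have "\<dots> \<le> (\<Sum>i\<in>T j. card {k \<in> J. i \<in> T k})"
      using T[OF less.prems(1)] fin by (intro card_UN_le) (auto intro: finite_subset)
    also have "\<dots> \<le> (\<Sum>i\<in>T j. b)" using T[OF less.prems(1)] by (intro sum_mono cardJ) auto
    also have "\<dots> \<le> a * b" using cardT[OF less.prems(1)] by simp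
    finally have S1: "real (card S1) \<le> a * b" by (metis of_nat_le_iff of_nat_mult)
    have "determined_by (I - T j) \<Omega> (G S2)"
      unfolding determined_by_def
    proof (intro conjI ballI impI)
      fix \<omega> \<omega>' assume *: "\<omega> \<in> G S2" "\<omega>' \<in> \<Omega>" "\<forall>e\<in>I - T j. \<omega> e = \<omega>' e"
      have "\<omega>' \<notin> A k" if k: "k \<in> S2" for k
      proof
        assume "\<omega>' \<in> A k"
        have kJ: "k \<in> J" using k less.prems by (auto simp: S2_def)
        have "T k \<subseteq> I - T j" using T[OF kJ] k by (auto simp: S1_def S2_def)
        then have "\<omega> \<in> A k"
          by (intro determined_byD[OF det[OF kJ] \<open>\<omega>' \<in> A k\<close>]) (use * in \<open>auto simp: G_def\<close>)
        then show False using * k by (auto simp: G_def)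
      qed
      then show "\<omega>' \<in> G S2" using * by (auto simp: G_def)
    qed (auto simp: G_def)
    then have "card (A j \<inter> G S2) * card \<Omega> = card (A j) * card (G S2)"
      using card_Int_determined[OF \<Omega>(1) det[OF less.prems(1)]] by blast
    then have "real (card (A j \<inter> G S2)) * card \<Omega> = card (A j) * real (card (G S2))"
      by (metis of_nat_mult)
    also have "\<dots> \<le> p * card \<Omega> * card (G S2)"
      using p[OF less.prems(1)] by (intro mult_right_mono) auto
    finally have "real (card (A j \<inter> G S2)) * card \<Omega> \<le> (p * card (G S2)) * card \<Omega>"
      by (simp add: mult_ac)
    moreover have "0 < real (card \<Omega>)" using \<Omega> by (simp add: card_gt_0_iff)
    ultimately have 1: "real (card (A j \<inter> G S2)) \<le> p * card (G S2)"
      by (rule mult_right_le_imp_le)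
    have "real (card (G S2)) \<le> 2 * card (G S)"
    \<comment> \<open>If nothing in \<open>S\<close> is related to \<open>j\<close>, then
      \<open>S2\<close> is \<open>S\<close> and the induction hypothesis does not apply to it, but
      no factor is lost either.\<close>
    proof (cases "S1 = {}")
      case True
      then show ?thesis by (simp add: S2_def)
    next
      case False
      then have "card S2 < card S"
        using finS unfolding S2_def by (intro psubset_card_mono) (auto simp: S1_def)
      then have IH: "real (card (A k \<inter> G S2)) \<le> 2 * p * card (G S2)" if "k \<in> S1" for k
        using less.hyps[of S2 k] less.prems that by (auto simp: S1_def S2_def)
      have "G S2 \<subseteq> G S \<union> (\<Union>k\<in>S1. A k \<inter> G S2)" by (auto simp: G_def S2_def)
      then have "card (G S2) \<le> card (G S \<union> (\<Union>k\<in>S1. A k \<inter> G S2))"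
        using finS finG by (intro card_mono) (auto simp: S1_def)
      also have "\<dots> \<le> card (G S) + card (\<Union>k\<in>S1. A k \<inter> G S2)" by (rule card_Un_le)
      finally have "card (G S2) \<le> card (G S) + card (\<Union>k\<in>S1. A k \<inter> G S2)" .
      moreover have "card (\<Union>k\<in>S1. A k \<inter> G S2) \<le> (\<Sum>k\<in>S1. card (A k \<inter> G S2))"
        using finS by (intro card_UN_le) (auto simp: S1_def)
      ultimately have "card (G S2) \<le> card (G S) + (\<Sum>k\<in>S1. card (A k \<inter> G S2))" by linarith
      then have "real (card (G S2)) \<le> real (card (G S) + (\<Sum>k\<in>S1. card (A k \<inter> G S2)))"
        by (simp only: of_nat_le_iff)
      then have "real (card (G S2)) \<le> card (G S) + (\<Sum>k\<in>S1. real (card (A k \<inter> G S2)))"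
        by simp
      moreover have "(\<Sum>k\<in>S1. real (card (A k \<inter> G S2))) \<le> card (G S2) / 2"
      proof -
        have "(\<Sum>k\<in>S1. real (card (A k \<inter> G S2))) \<le> (\<Sum>k\<in>S1. 2 * p * card (G S2))"
          by (intro sum_mono IH)
        also have "\<dots> = card S1 * (2 * p * card (G S2))" by simp
        also have "\<dots> \<le> a * b * (2 * p * card (G S2))"
          using S1 small(1) by (intro mult_right_mono) auto
        also have "\<dots> = 4 * p * a * b * (card (G S2) / 2)" by simp
        also have "\<dots> \<le> 1 * (card (G S2) / 2)" using small(2) by (intro mult_right_mono) auto
        finally show ?thesis by simp
      qed
      ultimately show ?thesis by linarith
    qed
    then have "p * card (G S2) \<le> p * (2 * card (G S))" using small(1) by (intro mult_left_mono) auto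
    moreover have "card (A j \<inter> G S) \<le> card (A j \<inter> G S2)"
      using finG by (intro card_mono) (auto simp: G_def S2_def)
    ultimately show ?case using 1 by linarith
  qed
  have "G S \<noteq> {}" if "finite S" "S \<subseteq> J" for S
    using that
  proof (induction S)
    case empty
    then show ?case using \<Omega> by (simp add: G_def)
  next
    case (insert j S)
    then have pos: "0 < real (card (G S))" by (simp add: card_gt_0_iff finG)
    have "G S = G (insert j S) \<union> (A j \<inter> G S)" by (auto simp: G_def)
    then have "card (G S) \<le> card (G (insert j S)) + card (A j \<inter> G S)" by (metis card_Un_le)
    then have "real (card (G S)) \<le> card (G (insert j S)) + 2 * p * card (G S)"
      using key[of j S] insert.prems by fastforce
    moreover have "2 * p * card (G S) < 1 * real (card (G S))" using pos small(3) by (intro mult_strict_right_mono)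
    ultimately show ?case by (metis add.left_neutral card.empty leD mult_1 of_nat_0)
  qed
  from this[OF fin(2)] show ?thesis by (auto simp: G_def)
qed

subsection \<open>Counting zeros of random functions\<close>

text \<open>This is the generating function of the number of zeros in \<open>A\<close>. Coordinates
  are uniform and independent, so it factors, and each coordinate in \<open>A\<close> contributes
  the mean 1 + (x - 1) / N.\<close>

lemma sum_power_card_zeros:
  fixes x :: real
  assumes "finite E" "A \<subseteq> E" "0 < N"
  shows "(\<Sum>\<omega>\<in>Pi\<^sub>E E (\<lambda>_. {..<N}). x ^ card {e \<in> A. \<omega> e = 0}) =
    real (card (Pi\<^sub>E E (\<lambda>_. {..<N::nat}))) * (1 + (x - 1) / N) ^ card A"
proof -
  have eq: "(\<Sum>k<N. if e \<in> A \<and> k = 0 then x else 1) = N * (if e \<in> A then 1 + (x - 1) / N else 1)" for e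
  proof -
    have "real N * (1 + (x - 1) / N) = N + x - 1" using assms(3) by (simp add: distrib_left)
    moreover obtain n where "N = Suc n" using assms(3) by (cases N) auto
    ultimately show ?thesis by (simp add: sum.lessThan_Suc_shift del: sum.lessThan_Suc)
  qed
  have "(\<Sum>\<omega>\<in>Pi\<^sub>E E (\<lambda>_. {..<N}). x ^ card {e \<in> A. \<omega> e = 0}) =
      (\<Sum>\<omega>\<in>Pi\<^sub>E E (\<lambda>_. {..<N}). \<Prod>e\<in>E. if e \<in> A \<and> \<omega> e = 0 then x else 1)"
  proof (rule sum.cong)
    fix \<omega> :: "'a \<Rightarrow> nat"
    have "(\<Prod>e\<in>E. if e \<in> A \<and> \<omega> e = 0 then x else 1) = (\<Prod>e\<in>{e \<in> E. e \<in> A \<and> \<omega> e = 0}. x)"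
      using assms(1) by (rule prod.inter_filter[symmetric])
    also have "{e \<in> E. e \<in> A \<and> \<omega> e = 0} = {e \<in> A. \<omega> e = 0}" using assms(2) by blast
    finally show "x ^ card {e \<in> A. \<omega> e = 0} = (\<Prod>e\<in>E. if e \<in> A \<and> \<omega> e = 0 then x else 1)"
      by simp
  qed simp
  also have "\<dots> = (\<Prod>e\<in>E. \<Sum>k<N. if e \<in> A \<and> k = 0 then x else 1)"
    using assms(1) by (subst prod_sum_PiE) auto
  also have "\<dots> = (\<Prod>e\<in>E. real N) * (\<Prod>e\<in>E. if e \<in> A then 1 + (x - 1) / N else 1)"
    by (simp only: eq prod.distrib)
  also have "(\<Prod>e\<in>E. if e \<in> A then 1 + (x - 1) / N else 1) = (\<Prod>e\<in>{e \<in> E. e \<in> A}. 1 + (x - 1) / N)"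
    using assms(1) by (rule prod.inter_filter[symmetric])
  also have "{e \<in> E. e \<in> A} = A" using assms(2) by blast
  finally show ?thesis using assms(1) by (simp add: card_PiE)
qed

text \<open>Markov's inequality for 2 to the number of zeros, with 1 + 1/N \<le> exp (1/N).\<close>

lemma card_many_zeros_le:
  assumes "finite E" "A \<subseteq> E" "0 < N"
  shows "real (card {\<omega> \<in> Pi\<^sub>E E (\<lambda>_. {..<N}). m < card {e \<in> A. \<omega> e = 0}})
    \<le> exp (card A / N) / 2 ^ m * card (Pi\<^sub>E E (\<lambda>_. {..<N::nat}))"
proof -
  let ?\<Omega> = "Pi\<^sub>E E (\<lambda>_. {..<N})"
  have fin: "finite ?\<Omega>" using assms by (intro finite_PiE) auto
  have "real (card {\<omega> \<in> ?\<Omega>. m < card {e \<in> A. \<omega> e = 0}}) * 2 ^ m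
      = (\<Sum>\<omega>\<in>{\<omega> \<in> ?\<Omega>. m < card {e \<in> A. \<omega> e = 0}}. 2 ^ m)" by simp
  also have "\<dots> \<le> (\<Sum>\<omega>\<in>{\<omega> \<in> ?\<Omega>. m < card {e \<in> A. \<omega> e = 0}}. 2 ^ card {e \<in> A. \<omega> e = 0})"
    by (intro sum_mono power_increasing) auto
  also have "\<dots> \<le> (\<Sum>\<omega>\<in>?\<Omega>. 2 ^ card {e \<in> A. \<omega> e = 0})"
    using fin by (intro sum_mono2) auto
  also have "\<dots> = real (card ?\<Omega>) * (1 + (2 - 1) / N) ^ card A"
    by (rule sum_power_card_zeros[OF assms])
  also have "\<dots> \<le> real (card ?\<Omega>) * exp (1 / N) ^ card A"
    using exp_ge_add_one_self[of "1 / N"] by (intro mult_left_mono power_mono) auto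
  also have "exp (1 / N) ^ card A = exp (card A / N)" by (simp add: exp_of_nat_mult[symmetric])
  finally show ?thesis by (simp add: field_simps)
qed

lemma card_few_zeros_le:
  assumes "finite E" "A \<subseteq> E" "0 < N"
  shows "real (card {\<omega> \<in> Pi\<^sub>E E (\<lambda>_. {..<N}). card {e \<in> A. \<omega> e = 0} < m})
    \<le> 2 ^ m * exp (- (card A / (2 * N))) * card (Pi\<^sub>E E (\<lambda>_. {..<N::nat}))"
proof -
  let ?\<Omega> = "Pi\<^sub>E E (\<lambda>_. {..<N})"
  have fin: "finite ?\<Omega>" using assms by (intro finite_PiE) auto
  have "real (card {\<omega> \<in> ?\<Omega>. card {e \<in> A. \<omega> e = 0} < m}) * (1 / 2) ^ m
      = (\<Sum>\<omega>\<in>{\<omega> \<in> ?\<Omega>. card {e \<in> A. \<omega> e = 0} < m}. (1 / 2) ^ m)" by simp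
  also have "\<dots> \<le> (\<Sum>\<omega>\<in>{\<omega> \<in> ?\<Omega>. card {e \<in> A. \<omega> e = 0} < m}. (1 / 2) ^ card {e \<in> A. \<omega> e = 0})"
    by (intro sum_mono power_decreasing) auto
  also have "\<dots> \<le> (\<Sum>\<omega>\<in>?\<Omega>. (1 / 2) ^ card {e \<in> A. \<omega> e = 0})"
    using fin by (intro sum_mono2) auto
  also have "\<dots> = real (card ?\<Omega>) * (1 + (1 / 2 - 1) / N) ^ card A"
    by (rule sum_power_card_zeros[OF assms])
  also have "\<dots> \<le> real (card ?\<Omega>) * exp (- (1 / (2 * N))) ^ card A"
    using exp_ge_add_one_self[of "- (1 / (2 * N))"] assms(3)
    by (intro mult_left_mono power_mono) (auto simp: field_simps)
  also have "exp (- (1 / (2 * N))) ^ card A = exp (- (card A / (2 * N)))"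
    by (simp add: exp_of_nat_mult[symmetric])
  finally show ?thesis by (simp add: field_simps)
qed

lemma card_all_zero:
  assumes "finite E" "Q \<subseteq> E" "0 < N"
  shows "real (card {\<omega> \<in> Pi\<^sub>E E (\<lambda>_. {..<N}). \<forall>e\<in>Q. \<omega> e = 0})
    = card (Pi\<^sub>E E (\<lambda>_. {..<N::nat})) / N ^ card Q"
proof -
  have "{\<omega> \<in> Pi\<^sub>E E (\<lambda>_. {..<N}). \<forall>e\<in>Q. \<omega> e = 0} = Pi\<^sub>E E (\<lambda>e. if e \<in> Q then {0} else {..<N})"
    using assms by (fastforce simp: PiE_iff split: if_splits)
  then have "card {\<omega> \<in> Pi\<^sub>E E (\<lambda>_. {..<N}). \<forall>e\<in>Q. \<omega> e = 0} = (\<Prod>e\<in>E. if e \<in> Q then 1 else N)"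
    using assms(1) by (simp add: card_PiE if_distrib cong: if_cong prod.cong)
  also have "\<dots> = (\<Prod>e\<in>E - Q. N)"
    using assms by (intro prod.mono_neutral_cong_right) auto
  also have "\<dots> = N ^ (card E - card Q)"
    using assms by (simp add: card_Diff_subset finite_subset)
  finally show ?thesis
    using assms card_mono[OF assms(1,2)] by (simp add: card_PiE power_diff[of "real N"])
qed

text \<open>The left side is the elementary symmetric polynomial of degree \<open>n\<close>, whose
  terms all occur in the expansion of the power. The induction splits the subsets by membership of
  \<open>a\<close>.\<close>

lemma sum_prod_subsets_le:
  fixes w :: "'a \<Rightarrow> real"
  assumes "finite A" "\<And>a. a \<in> A \<Longrightarrow> 0 \<le> w a"
  shows "(\<Sum>Q | Q \<subseteq> A \<and> card Q = n. \<Prod>e\<in>Q. w e) \<le> (\<Sum>a\<in>A. w a) ^ n"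
  using assms
proof (induction A arbitrary: n rule: finite_induct)
  case empty
  show ?case
  proof (cases n)
    case 0
    have "{Q :: 'a set. Q \<subseteq> {} \<and> card Q = 0} = {{}}" by auto
    then show ?thesis using 0 by simp
  qed (auto intro: sum_nonpos)
next
  case (insert a A)
  have fin: "finite Q" if "Q \<subseteq> A" for Q using that insert.hyps finite_subset by blast
  have S0: "0 \<le> (\<Sum>a\<in>A. w a)" using insert.prems by (intro sum_nonneg) auto
  show ?case
  proof (cases n)
    case 0
    have "{Q. Q \<subseteq> insert a A \<and> card Q = 0} = {{}}"
      using insert.hyps by (auto dest: finite_subset)
    then show ?thesis using 0 by simp
  next
    case (Suc m)
    have eq: "{Q. Q \<subseteq> insert a A \<and> card Q = n}
        = {Q. Q \<subseteq> A \<and> card Q = n} \<union> insert a ` {Q. Q \<subseteq> A \<and> card Q = m}" (is "?L = ?R")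
    proof
      show "?L \<subseteq> ?R"
      proof
        fix Q assume Q: "Q \<in> ?L"
        then have finQ: "finite Q" using insert.hyps by (auto intro: finite_subset)
        show "Q \<in> ?R"
        proof (cases "a \<in> Q")
          case True
          then have "Q - {a} \<subseteq> A" "card (Q - {a}) = m" "Q = insert a (Q - {a})"
            using Q Suc finQ by auto
          then show ?thesis by blast
        qed (use Q in auto)
      qed
      show "?R \<subseteq> ?L" using Suc insert.hyps fin by (auto simp: card_insert_if)
    qed
    have inj: "inj_on (insert a) {Q. Q \<subseteq> A \<and> card Q = m}"
      using insert.hyps by (intro inj_onI) (metis (no_types, lifting) Diff_insert_absorb mem_Collect_eq subsetD)
    have "(\<Sum>Q | Q \<subseteq> insert a A \<and> card Q = n. \<Prod>e\<in>Q. w e)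
      = (\<Sum>Q | Q \<subseteq> A \<and> card Q = n. \<Prod>e\<in>Q. w e) + (\<Sum>Q\<in>insert a ` {Q. Q \<subseteq> A \<and> card Q = m}. \<Prod>e\<in>Q. w e)"
      unfolding eq using insert.hyps by (intro sum.union_disjoint) auto
    also have "(\<Sum>Q\<in>insert a ` {Q. Q \<subseteq> A \<and> card Q = m}. \<Prod>e\<in>Q. w e)
        = (\<Sum>Q | Q \<subseteq> A \<and> card Q = m. \<Prod>e\<in>insert a Q. w e)"
      by (subst sum.reindex[OF inj]) simp
    also have "\<dots> = (\<Sum>Q | Q \<subseteq> A \<and> card Q = m. w a * (\<Prod>e\<in>Q. w e))"
      using insert.hyps fin by (intro sum.cong) (auto simp: prod.insert_if)
    also have "\<dots> = w a * (\<Sum>Q | Q \<subseteq> A \<and> card Q = m. \<Prod>e\<in>Q. w e)"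
      by (simp add: sum_distrib_left)
    also have "\<dots> \<le> w a * (\<Sum>a\<in>A. w a) ^ m"
      using insert.IH[of m] insert.prems by (intro mult_left_mono) auto
    finally have "(\<Sum>Q | Q \<subseteq> insert a A \<and> card Q = n. \<Prod>e\<in>Q. w e)
        \<le> (\<Sum>a\<in>A. w a) ^ n + w a * (\<Sum>a\<in>A. w a) ^ m"
      using insert.IH[of n] insert.prems by force
    also have "\<dots> = (w a + (\<Sum>a\<in>A. w a)) * (\<Sum>a\<in>A. w a) ^ m" using Suc by (simp add: algebra_simps)
    also have "\<dots> \<le> (w a + (\<Sum>a\<in>A. w a)) * (w a + (\<Sum>a\<in>A. w a)) ^ m"
      using S0 insert.prems by (intro mult_left_mono power_mono) auto
    finally show ?thesis using insert.hyps Suc by simp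
  qed
qed

text \<open>A union bound over \<open>Q\<close>. Disjointness of the sets \<open>m e\<close> makes
  the probability for one \<open>Q\<close> a product, and the sum over all \<open>Q\<close> is at
  most the \<open>n\<close>-th power of the expected number of \<open>e\<close> with
  \<open>m e\<close> entirely zero.\<close>

lemma card_pattern_le:
  assumes "finite E" "A \<subseteq> E" "0 < N" and m: "\<And>e. e \<in> A \<Longrightarrow> m e \<subseteq> E"
    and disj: "\<And>e f. e \<in> A \<Longrightarrow> f \<in> A \<Longrightarrow> e \<noteq> f \<Longrightarrow> m e \<inter> m f = {}"
  shows "real (card {\<omega> \<in> Pi\<^sub>E E (\<lambda>_. {..<N}). \<exists>Q\<subseteq>A. card Q = n \<and> (\<forall>e\<in>Q. \<forall>f\<in>m e. \<omega> f = 0)})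
    \<le> (\<Sum>e\<in>A. 1 / real N ^ card (m e)) ^ n * card (Pi\<^sub>E E (\<lambda>_. {..<N::nat}))"
proof -
  let ?\<Omega> = "Pi\<^sub>E E (\<lambda>_. {..<N})" and ?Q = "{Q. Q \<subseteq> A \<and> card Q = n}"
  have finA: "finite A" using assms(1,2) finite_subset by blast
  have fin: "finite ?\<Omega>" using assms by (intro finite_PiE) auto
  have "{\<omega> \<in> ?\<Omega>. \<exists>Q\<subseteq>A. card Q = n \<and> (\<forall>e\<in>Q. \<forall>f\<in>m e. \<omega> f = 0)}
      = (\<Union>Q\<in>?Q. {\<omega> \<in> ?\<Omega>. \<forall>f\<in>(\<Union>e\<in>Q. m e). \<omega> f = 0})" by blast
  then have "card {\<omega> \<in> ?\<Omega>. \<exists>Q\<subseteq>A. card Q = n \<and> (\<forall>e\<in>Q. \<forall>f\<in>m e. \<omega> f = 0)}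
      \<le> (\<Sum>Q\<in>?Q. card {\<omega> \<in> ?\<Omega>. \<forall>f\<in>(\<Union>e\<in>Q. m e). \<omega> f = 0})"
    using finA by (simp only:) (intro card_UN_le, simp)
  then have "real (card {\<omega> \<in> ?\<Omega>. \<exists>Q\<subseteq>A. card Q = n \<and> (\<forall>e\<in>Q. \<forall>f\<in>m e. \<omega> f = 0)})
      \<le> (\<Sum>Q\<in>?Q. real (card {\<omega> \<in> ?\<Omega>. \<forall>f\<in>(\<Union>e\<in>Q. m e). \<omega> f = 0}))"
    by (simp only: of_nat_le_iff of_nat_sum[symmetric])
  also have "\<dots> = (\<Sum>Q\<in>?Q. (\<Prod>e\<in>Q. 1 / real N ^ card (m e)) * card ?\<Omega>)"
  proof (rule sum.cong)
    fix Q assume "Q \<in> ?Q"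
    then have Q: "Q \<subseteq> A" "finite Q" using finA finite_subset by blast+
    have "card (\<Union>e\<in>Q. m e) = (\<Sum>e\<in>Q. card (m e))"
      using Q m disj finite_subset[OF m assms(1)] by (intro card_UN_disjoint) blast+
    moreover have "(\<Union>e\<in>Q. m e) \<subseteq> E" using Q m by blast
    ultimately show "real (card {\<omega> \<in> ?\<Omega>. \<forall>f\<in>(\<Union>e\<in>Q. m e). \<omega> f = 0})
        = (\<Prod>e\<in>Q. 1 / real N ^ card (m e)) * card ?\<Omega>"
      by (subst card_all_zero) (use assms(1,3) in \<open>auto simp: power_sum prod_dividef\<close>)
  qed simp
  also have "\<dots> = (\<Sum>Q\<in>?Q. \<Prod>e\<in>Q. 1 / real N ^ card (m e)) * card ?\<Omega>"
    by (rule sum_distrib_right[symmetric])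
  also have "\<dots> \<le> (\<Sum>e\<in>A. 1 / real N ^ card (m e)) ^ n * card ?\<Omega>"
    using finA by (intro mult_right_mono sum_prod_subsets_le) auto
  finally show ?thesis .
qed

subsection \<open>A sparse random set of edges\<close>

text \<open>The root is rounded to an integer because the density 1 / r^3 is realised as one value
  out of r^3. The bound 10^20 = (10^5)^4 provides the size of r used in the numerical
  estimates.\<close>

lemma fourth_root_bounds:
  assumes "10 ^ 20 < (\<Delta>::nat)"
  obtains r where "10 ^ 5 \<le> r" "r ^ 4 \<le> \<Delta>" "\<Delta> < (r + 1) ^ 4"
proof -
  define r where "r = (LEAST k. \<Delta> < (k + 1) ^ 4)"
  have "\<Delta> < (\<Delta> + 1) ^ 4" using self_le_power[of "\<Delta> + 1" 4] by linarith
  then have ub: "\<Delta> < (r + 1) ^ 4" unfolding r_def by (rule LeastI)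
  have "r ^ 4 \<le> \<Delta>"
  proof (cases r)
    case (Suc k)
    then have "\<not> \<Delta> < (k + 1) ^ 4" using not_less_Least[of k "\<lambda>k. \<Delta> < (k + 1) ^ 4"] by (simp add: r_def)
    then show ?thesis using Suc by simp
  qed simp
  moreover have "10 ^ 5 \<le> r"
  proof (rule ccontr)
    assume "\<not> ?thesis"
    then have "(r + 1) ^ 4 \<le> (10 ^ 5) ^ 4" by (intro power_mono) auto
    then show False using ub assms by simp
  qed
  ultimately show ?thesis using that ub by blast
qed

section \<open>Numerical estimates behind the local lemma\<close>

context
  fixes r \<Delta> :: nat
  assumes r: "10 ^ 5 \<le> r" "r ^ 4 \<le> \<Delta>" "\<Delta> < (r + 1) ^ 4"
begin

lemma square_le_r: "(real \<Delta>)\<^sup>2 \<le> 256 * real r ^ 8"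
proof -
  have "real \<Delta> \<le> real ((r + 1) ^ 4)" using r(3) by (simp only: of_nat_le_iff)
  also have "\<dots> \<le> real ((2 * r) ^ 4)" using r(1) by (intro of_nat_mono power_mono) auto
  finally have "real \<Delta> \<le> 16 * real r ^ 4" by (simp add: power_mult_distrib)
  then have "(real \<Delta>)\<^sup>2 \<le> (16 * real r ^ 4)\<^sup>2" by (intro power_mono) auto
  then show ?thesis by (simp add: power_mult_distrib power_mult[symmetric])
qed

lemma ratio_le: "real \<Delta> \<le> 11 / 10 * real r ^ 4"
proof -
  have "real \<Delta> \<le> real ((r + 1) ^ 4)" using r(3) by (simp only: of_nat_le_iff)
  also have "\<dots> = (real r + 1) ^ 4" by (simp add: add.commute)
  also have "\<dots> \<le> (101 / 100 * real r) ^ 4" using r(1) by (intro power_mono) auto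
  also have "\<dots> = (101 / 100) ^ 4 * real r ^ 4" by (rule power_mult_distrib)
  also have "\<dots> \<le> 11 / 10 * real r ^ 4" by (intro mult_right_mono) (auto simp: field_simps)
  finally show ?thesis .
qed

text \<open>The exponential dominates thirty factors r / 960 \<ge> 100: eight match the r^8 in the
  bound for \<Delta>^2, and 22 absorb the constants. Here 96 = 2 * 48, since two tail events share
  the bound 1 / (48 \<Delta>^2).\<close>

lemma exp_tail: "exp (- (real r / 32)) \<le> 1 / (96 * (real \<Delta>)\<^sup>2)"
proof -
  have "real r / 960 \<le> exp (real r / 960)"
    using exp_ge_add_one_self[of "real r / 960"] by linarith
  then have "(real r / 960) ^ 30 \<le> exp (real r / 960) ^ 30" by (intro power_mono) auto
  also have "\<dots> = exp (real r / 32)" by (simp add: exp_of_nat_mult[symmetric])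
  finally have e: "(real r / 960) ^ 30 \<le> exp (real r / 32)" .
  have "100 ^ 22 \<le> (real r / 960) ^ 22" using r(1) by (intro power_mono) auto
  then have "100 ^ 22 * (real r / 960) ^ 8 \<le> (real r / 960) ^ 22 * (real r / 960) ^ 8"
    by (intro mult_right_mono) auto
  also have "\<dots> = (real r / 960) ^ 30" by (simp add: power_add[symmetric])
  finally have "100 ^ 22 * (real r / 960) ^ 8 \<le> (real r / 960) ^ 30" .
  moreover have "24576 * real r ^ 8 \<le> 100 ^ 22 * (real r / 960) ^ 8"
  proof -
    have "24576 * real r ^ 8 \<le> (100 ^ 22 / 960 ^ 8) * real r ^ 8"
      by (intro mult_right_mono) (auto simp: field_simps)
    then show ?thesis by (simp add: power_divide)
  qed
  ultimately have "96 * (real \<Delta>)\<^sup>2 \<le> exp (real r / 32)" using e square_le_r by linarith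
  moreover have "0 < real \<Delta>" using r by (cases "\<Delta> = 0") auto
  ultimately show ?thesis by (simp add: exp_minus field_simps)
qed

text \<open>The expected number of zeros exceeds r / 4, which gives exp (- r / 8). The threshold is
  at most r / 8, and 2 \<le> exp (3/4) bounds its factor by exp (3 r / 32), so exp (- r / 32)
  remains.\<close>

lemma few_zeros_bound:
  assumes "\<Delta> < 4 * n"
  shows "2 ^ (6 * (r div 48)) * exp (- (n / (2 * real (r ^ 3)))) \<le> 1 / (96 * (real \<Delta>)\<^sup>2)"
proof -
  have rpos: "0 < real r" using r by auto
  have "2 \<le> exp (3 / 4 :: real)" using exp_lower_Taylor_quadratic[of "3 / 4 :: real"]
    by (simp add: power2_eq_square)
  then have "2 ^ (6 * (r div 48)) \<le> exp (3 / 4 :: real) ^ (6 * (r div 48))" by (intro power_mono) auto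
  also have "\<dots> = exp (real (6 * (r div 48)) * (3 / 4))" by (rule exp_of_nat_mult[symmetric])
  also have "\<dots> \<le> exp (3 * real r / 32)"
  proof -
    have "8 * (6 * (r div 48)) \<le> r" by linarith
    then have "8 * real (6 * (r div 48)) \<le> real r" by linarith
    then show ?thesis by simp
  qed
  finally have 1: "2 ^ (6 * (r div 48)) \<le> exp (3 * real r / 32)" .
  have "r ^ 4 \<le> 4 * n" using assms r(2) by linarith
  then have "real (r ^ 4) \<le> real (4 * n)" by (simp only: of_nat_le_iff)
  then have "real r * real r ^ 3 \<le> 4 * real n" by (simp add: power_numeral_reduce)
  then have "real r / 8 \<le> n / (2 * real (r ^ 3))" using rpos by (simp add: field_simps)
  then have 2: "exp (- (n / (2 * real (r ^ 3)))) \<le> exp (- (real r / 8))" by simp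
  have "2 ^ (6 * (r div 48)) * exp (- (n / (2 * real (r ^ 3)))) \<le> exp (3 * real r / 32) * exp (- (real r / 8))"
    using 1 2 by (intro mult_mono) auto
  also have "\<dots> = exp (- (real r / 32))" by (simp add: exp_add[symmetric])
  finally show ?thesis using exp_tail by linarith
qed

text \<open>The mean is at most 11/10 r, while 2^(2 r) \<ge> exp (6/5 r); this margin is why the
  ratio of \<open>\<Delta>\<close> to r^4 is estimated sharply.\<close>

lemma many_zeros_bound:
  assumes "n \<le> \<Delta>"
  shows "exp (n / real (r ^ 3)) / 2 ^ (2 * r) \<le> 1 / (96 * (real \<Delta>)\<^sup>2)"
proof -
  have rpos: "0 < real r" using r by auto
  have "exp (3 / 5 :: real) \<le> 2" using exp_bound[of "3 / 5 :: real"] by (simp add: power2_eq_square)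
  then have "exp (3 / 5 :: real) ^ (2 * r) \<le> 2 ^ (2 * r)" by (intro power_mono) auto
  then have 1: "exp (6 * real r / 5) \<le> 2 ^ (2 * r)" by (simp add: exp_of_nat_mult[symmetric] mult_ac)
  have "real n \<le> real \<Delta>" using assms by simp
  also have "\<dots> \<le> 11 / 10 * real r ^ 4" by (rule ratio_le)
  also have "\<dots> = 11 / 10 * real r * real (r ^ 3)" by (simp add: power_Suc[symmetric] del: power_Suc)
  finally have "n / real (r ^ 3) \<le> 11 / 10 * real r" using rpos by (simp add: field_simps)
  then have "exp (n / real (r ^ 3)) / 2 ^ (2 * r) \<le> exp (11 / 10 * real r) / exp (6 * real r / 5)"
    using 1 by (intro frac_le) auto
  also have "\<dots> = exp (- (real r / 10))" by (simp add: exp_diff[symmetric] field_simps)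
  also have "\<dots> \<le> exp (- (real r / 32))" by simp
  finally show ?thesis using exp_tail by linarith
qed

text \<open>As \<open>s\<close> is at most 2 / r^2, its fifth power has order r^(-10), below the
  order r^(-8) of 1 / \<Delta>^2. A fourth power would only reach the same order; hence five
  edges.\<close>

lemma pattern_bound:
  fixes s :: real
  assumes "0 \<le> s" "s \<le> 300 / real (r ^ 3) + \<Delta> / (real (r ^ 3))\<^sup>2"
  shows "s ^ 5 \<le> 1 / (48 * (real \<Delta>)\<^sup>2)"
proof -
  have rpos: "0 < real r" using r by auto
  have "300 / real (r ^ 3) \<le> (1 / 2) / real r ^ 2"
    using r(1) rpos by (simp add: field_simps power_numeral_reduce)
  moreover have "\<Delta> / (real (r ^ 3))\<^sup>2 \<le> (11 / 10) / real r ^ 2"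
  proof -
    have "\<Delta> / (real (r ^ 3))\<^sup>2 \<le> (11 / 10 * real r ^ 4) / (real (r ^ 3))\<^sup>2"
      using ratio_le by (intro divide_right_mono) auto
    also have "\<dots> = (11 / 10) / real r ^ 2" using rpos by (simp add: field_simps power_numeral_reduce)
    finally show ?thesis .
  qed
  ultimately have "s \<le> (1 / 2) / real r ^ 2 + (11 / 10) / real r ^ 2" using assms(2) by linarith
  also have "\<dots> = (16 / 10) / real r ^ 2" by (simp add: add_divide_distrib[symmetric])
  also have "\<dots> \<le> 2 / real r ^ 2" by (intro divide_right_mono) auto
  finally have "s \<le> 2 / real r ^ 2" .
  then have "s ^ 5 \<le> (2 / real r ^ 2) ^ 5" using assms(1) by (intro power_mono) auto
  also have "\<dots> = 32 / real r ^ 10" by (simp add: power_divide power_mult[symmetric])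
  also have "\<dots> \<le> 1 / (48 * (real \<Delta>)\<^sup>2)"
  proof -
    have "1536 * (real \<Delta>)\<^sup>2 \<le> 393216 * real r ^ 8" using square_le_r by linarith
    also have "\<dots> \<le> (real r)\<^sup>2 * real r ^ 8"
    proof (intro mult_right_mono)
      have "(10 ^ 5)\<^sup>2 \<le> (real r)\<^sup>2" using r(1) by (intro power_mono) auto
      then show "393216 \<le> (real r)\<^sup>2" by simp
    qed simp
    also have "\<dots> = real r ^ 10" by (simp add: power_add[symmetric])
    finally have "1536 * (real \<Delta>)\<^sup>2 \<le> real r ^ 10" .
    moreover have "0 < real \<Delta>" using r by (cases "\<Delta> = 0") auto
    ultimately show ?thesis using rpos by (simp add: field_simps)
  qed
  finally show ?thesis .
qed

end

section \<open>Choosing the sparse set by the local lemma\<close>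

text \<open>Only \<open>X\<close> occurs and not its later subset \<open>H\<close>, so this is an
  event of the random choice. In a proper colouring the inner set is \<open>e\<close> alone if its
  colour is missing at \<open>v\<close>, and has one further edge otherwise.\<close>

definition clash :: "('e \<Rightarrow> 'v set) \<Rightarrow> 'e set \<Rightarrow> ('e \<Rightarrow> 'c) \<Rightarrow> 'e set \<Rightarrow> 'v \<Rightarrow> 'v \<Rightarrow> bool" where
  "clash ends E c X u v \<longleftrightarrow> (\<exists>Q\<subseteq>edges_at ends E u - edges_at ends E v. card Q = 5 \<and>
     (\<forall>e\<in>Q. \<forall>f\<in>insert e {f \<in> edges_at ends E v. c f = c e}. f \<in> X))"

lemma card_neighbours_le:
  assumes "finite E" "\<And>e. e \<in> E \<Longrightarrow> card (ends e) = 2"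
  shows "finite {v. \<exists>e\<in>E. ends e = {z, v}}"
    and "card {v. \<exists>e\<in>E. ends e = {z, v}} \<le> card (edges_at ends E z)"
proof -
  have fin: "finite (ends e)" if "e \<in> E" for e using assms(2)[OF that] by (intro card_ge_0_finite) auto
  have sub: "{v. \<exists>e\<in>E. ends e = {z, v}} \<subseteq> (\<Union>e\<in>edges_at ends E z. ends e - {z})"
    using assms(2) by (fastforce simp: edges_at_def)
  have finU: "finite (\<Union>e\<in>edges_at ends E z. ends e - {z})"
    using assms(1) fin by (auto simp: edges_at_def)
  show "finite {v. \<exists>e\<in>E. ends e = {z, v}}" using sub finU finite_subset by blast
  have "card {v. \<exists>e\<in>E. ends e = {z, v}} \<le> card (\<Union>e\<in>edges_at ends E z. ends e - {z})"
    using sub finU by (intro card_mono)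
  also have "\<dots> \<le> (\<Sum>e\<in>edges_at ends E z. card (ends e - {z}))"
    using assms(1) by (intro card_UN_le) simp
  also have "\<dots> = (\<Sum>e\<in>edges_at ends E z. 1)"
    using assms(2) fin by (intro sum.cong) (auto simp: edges_at_def)
  finally show "card {v. \<exists>e\<in>E. ends e = {z, v}} \<le> card (edges_at ends E z)" by simp
qed

text \<open>Selecting every edge with probability \<open>1 / r ^ 3 \<approx> \<Delta> powr (- 3 / 4)\<close> leaves about
  \<open>\<Delta> powr (1 / 4)\<close> edges at a vertex of large degree, concentrated enough for the local lemma,
  while two given vertices have only about \<open>\<Delta> powr (- 1 / 2)\<close> selected colours in common, and
  five common ones occur with probability far below \<open>1 / \<Delta>\<^sup>2\<close>.\<close>

lemma random_subset:
  fixes ends :: "'e \<Rightarrow> 'v set" and c :: "'e \<Rightarrow> 'c"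
  assumes "finite E" and two: "\<And>e. e \<in> E \<Longrightarrow> card (ends e) = 2"
    and deg: "\<And>w. card (edges_at ends E w) \<le> \<Delta>" and proper: "proper_on ends E c"
    and r: "10 ^ 5 \<le> r" "r ^ 4 \<le> \<Delta>" "\<Delta> < (r + 1) ^ 4"
  shows "\<exists>X\<subseteq>E. (\<forall>w. card (edges_at ends X w) \<le> 2 * r) \<and>
    (\<forall>w. \<Delta> < 4 * card (edges_at ends E w) \<longrightarrow> 6 * (r div 48) \<le> card (edges_at ends X w)) \<and>
    (\<forall>u v. (\<exists>e\<in>E. ends e = {u, v}) \<longrightarrow>
       card {e \<in> edges_at ends E u. c e \<notin> c ` edges_at ends E v} \<le> 300 \<longrightarrow> \<not> clash ends E c X u v)"
proof -
  define N where "N = r ^ 3"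
  define \<Omega> where "\<Omega> = Pi\<^sub>E E (\<lambda>_. {..<N})"
  have N: "0 < N" using r by (simp add: N_def)
  have fin\<Omega>: "finite \<Omega>" unfolding \<Omega>_def using assms(1) by (intro finite_PiE) auto
  have "\<Omega> \<noteq> {}" using N by (auto simp: \<Omega>_def PiE_eq_empty_iff)
  define inc where "inc = edges_at ends E"
  have fininc: "finite (inc w)" and incE: "inc w \<subseteq> E" for w
    using assms(1) edges_at_subset[of ends E w] by (auto simp: inc_def)
  define V where "V = (\<Union>e\<in>E. ends e)"
  \<comment> \<open>Edges whose colour is missing at \<open>v\<close> are selected with probability
    1 / N instead of 1 / N^2, so their number has to be bounded. Pairs beyond 300 stay distinguished
    anyway if at most 291 edges at \<open>u\<close> are recoloured with new colours.\<close>
  define P where "P = {(u, v). (\<exists>e\<in>E. ends e = {u, v}) \<and> card {e \<in> inc u. c e \<notin> c ` inc v} \<le> 300}"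
  define mates where "mates v e = insert e {f \<in> inc v. c f = c e}" for v e
  define many where "many w = {\<omega> \<in> \<Omega>. 2 * r < card {e \<in> inc w. \<omega> e = 0}}" for w
  define few where "few w = (if \<Delta> < 4 * card (inc w)
      then {\<omega> \<in> \<Omega>. card {e \<in> inc w. \<omega> e = 0} < 6 * (r div 48)} else {})" for w
  define pat where "pat u v = {\<omega> \<in> \<Omega>. \<exists>Q\<subseteq>inc u - inc v. card Q = 5 \<and>
      (\<forall>e\<in>Q. \<forall>f\<in>mates v e. \<omega> f = 0)}" for u v
  define J where "J = Inl ` V \<union> Inr ` P"
  define A where "A j = (case j of Inl w \<Rightarrow> many w \<union> few w | Inr (u, v) \<Rightarrow> pat u v)" for j
  define T where "T j = (case j of Inl w \<Rightarrow> inc w | Inr (u, v) \<Rightarrow> inc u \<union> inc v)" for j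
  \<comment> \<open>An event involves at most 2 \<Delta> edges and an edge at most 6 \<Delta>
    events; 48 = 4 * 2 * 6.\<close>
  define p where "p = 1 / (48 * (real \<Delta>)\<^sup>2)"
  have \<Delta>: "0 < \<Delta>" using r by (cases "\<Delta> = 0") auto
  have finV: "finite V" unfolding V_def using assms(1) two by (intro finite_UN_I) (auto intro: card_ge_0_finite)
  have PV: "P \<subseteq> V \<times> V" by (auto simp: P_def V_def)
  have finP: "finite P" using PV finV finite_subset by blast
  have det: "determined_by (T j) \<Omega> (A j)" if "j \<in> J" for j
  proof (cases j)
    case (Inl w)
    have "many w \<subseteq> \<Omega>" "few w \<subseteq> \<Omega>" by (auto simp: many_def few_def)
    moreover have "\<omega>' \<in> many w \<union> few w"
      if "\<omega> \<in> many w \<union> few w" "\<omega>' \<in> \<Omega>" "\<forall>e\<in>inc w. \<omega> e = \<omega>' e" for \<omega> \<omega>'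
    proof -
      have "{e \<in> inc w. \<omega> e = 0} = {e \<in> inc w. \<omega>' e = 0}" using that(3) by auto
      then show ?thesis using that by (auto simp: many_def few_def split: if_splits)
    qed
    ultimately show ?thesis by (auto simp: determined_by_def A_def T_def Inl)
  next
    case (Inr uv)
    obtain u v where uv: "uv = (u, v)" by fastforce
    have "\<omega>' \<in> pat u v" if \<omega>: "\<omega> \<in> pat u v" "\<omega>' \<in> \<Omega>" "\<forall>e\<in>inc u \<union> inc v. \<omega> e = \<omega>' e" for \<omega> \<omega>'
    proof -
      obtain Q where Q: "Q \<subseteq> inc u - inc v" "card Q = 5" "\<forall>e\<in>Q. \<forall>f\<in>mates v e. \<omega> f = 0"
        using \<omega>(1) by (auto simp: pat_def)
      have "\<forall>e\<in>Q. \<forall>f\<in>mates v e. \<omega>' f = 0"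
      proof (intro ballI)
        fix e f assume ef: "e \<in> Q" "f \<in> mates v e"
        then have "f \<in> inc u \<union> inc v" using Q(1) by (auto simp: mates_def)
        moreover have "\<omega> f = 0" using Q(3) ef by blast
        ultimately show "\<omega>' f = 0" using \<omega>(3) by metis
      qed
      then show ?thesis using Q \<omega>(2) unfolding pat_def by blast
    qed
    moreover have "pat u v \<subseteq> \<Omega>" by (auto simp: pat_def)
    ultimately show ?thesis unfolding determined_by_def A_def T_def Inr uv by simp
  qed
  have prob: "real (card (A j)) \<le> p * card \<Omega>" if "j \<in> J" for j
  proof (cases j)
    case (Inl w)
    have "real (card (many w)) \<le> exp (card (inc w) / N) / 2 ^ (2 * r) * card \<Omega>"
      unfolding many_def \<Omega>_def by (rule card_many_zeros_le[OF assms(1) incE N])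
    also have "\<dots> \<le> 1 / (96 * (real \<Delta>)\<^sup>2) * card \<Omega>"
      unfolding N_def by (intro mult_right_mono many_zeros_bound[OF r]) (use deg in \<open>auto simp: inc_def\<close>)
    finally have 1: "real (card (many w)) \<le> 1 / (96 * (real \<Delta>)\<^sup>2) * card \<Omega>" .
    have 2: "real (card (few w)) \<le> 1 / (96 * (real \<Delta>)\<^sup>2) * card \<Omega>"
    proof (cases "\<Delta> < 4 * card (inc w)")
      case True
      have "real (card {\<omega> \<in> \<Omega>. card {e \<in> inc w. \<omega> e = 0} < 6 * (r div 48)})
          \<le> 2 ^ (6 * (r div 48)) * exp (- (card (inc w) / (2 * real N))) * card \<Omega>"
        using card_few_zeros_le[OF assms(1) incE[of w] N, of "6 * (r div 48)"] by (simp add: \<Omega>_def)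
      also have "\<dots> \<le> 1 / (96 * (real \<Delta>)\<^sup>2) * card \<Omega>"
        using few_zeros_bound[OF r True] unfolding N_def by (intro mult_right_mono) auto
      finally show ?thesis using True by (simp add: few_def)
    qed (simp add: few_def)
    have "card (A j) \<le> card (many w) + card (few w)" by (simp add: A_def Inl card_Un_le)
    then have "real (card (A j)) \<le> real (card (many w)) + real (card (few w))" by linarith
    also have "\<dots> \<le> p * card \<Omega>" using 1 2 by (simp add: p_def)
    finally show ?thesis .
  next
    case (Inr uv)
    obtain u v where uv: "uv = (u, v)" by fastforce
    then have "(u, v) \<in> P" using that Inr by (auto simp: J_def)
    then have B: "card {e \<in> inc u. c e \<notin> c ` inc v} \<le> 300" by (simp add: P_def)
    have inj: "inj_on c (inc w)" for w unfolding inc_def by (rule proper_on_inj[OF proper])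
    have disj: "mates v e \<inter> mates v f = {}" if "e \<in> inc u - inc v" "f \<in> inc u - inc v" "e \<noteq> f" for e f
      using that inj_onD[OF inj[of u]] by (auto simp: mates_def)
    have "real (card (pat u v)) \<le> (\<Sum>e\<in>inc u - inc v. 1 / real N ^ card (mates v e)) ^ 5 * card \<Omega>"
      unfolding pat_def \<Omega>_def
      by (rule card_pattern_le) (use assms(1) N incE disj in \<open>auto simp: mates_def\<close>)
    also have "\<dots> \<le> p * card \<Omega>"
      unfolding p_def
    proof (intro mult_right_mono pattern_bound[OF r])
      show "0 \<le> (\<Sum>e\<in>inc u - inc v. 1 / real N ^ card (mates v e))" by (intro sum_nonneg) auto
      let ?B = "{e \<in> inc u. c e \<notin> c ` inc v}"
      \<comment> \<open>If the colour of \<open>e\<close> is missing at \<open>v\<close>, its set of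
        mates is just \<open>e\<close>, which happens at most 300 times. For the others, at most
        \<open>\<Delta>\<close> in number, it has exactly two elements.\<close>
      have "(\<Sum>e\<in>inc u - inc v. 1 / real N ^ card (mates v e))
          \<le> (\<Sum>e\<in>inc u - inc v. if e \<in> ?B then 1 / real N else 1 / (real N)\<^sup>2)"
      proof (rule sum_mono)
        fix e assume e: "e \<in> inc u - inc v"
        show "1 / real N ^ card (mates v e) \<le> (if e \<in> ?B then 1 / real N else 1 / (real N)\<^sup>2)"
        proof (cases "e \<in> ?B")
          case True
          then have "mates v e = {e}" by (auto simp: mates_def image_iff)
          then show ?thesis using True by simp
        next
          case False
          then obtain f where f: "f \<in> inc v" "c f = c e" using e by (auto simp: image_iff)
          have "mates v e = {e, f}"
            using f inj_onD[OF inj[of v]] by (auto simp: mates_def)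
          moreover have "e \<noteq> f" using e f by blast
          ultimately have "1 / real N ^ card (mates v e) = 1 / (real N)\<^sup>2"
            by (simp add: power2_eq_square)
          then show ?thesis using False by (simp only: if_False order_refl)
        qed
      qed
      also have "\<dots> \<le> (\<Sum>e\<in>inc u. if e \<in> ?B then 1 / real N else 1 / (real N)\<^sup>2)"
        using fininc by (intro sum_mono2) auto
      also have "\<dots> = (\<Sum>e\<in>?B. 1 / real N) + (\<Sum>e\<in>inc u - ?B. 1 / (real N)\<^sup>2)"
        using fininc[of u] by (subst sum.subset_diff[of ?B]) (auto intro!: sum.cong)
      also have "\<dots> \<le> 300 / real N + \<Delta> / (real N)\<^sup>2"
      proof (intro add_mono)
        show "(\<Sum>e\<in>?B. 1 / real N) \<le> 300 / real N" using B by (simp add: divide_right_mono)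
        have "card (inc u - ?B) \<le> card (inc u)" using fininc by (intro card_mono) auto
        also have "\<dots> \<le> \<Delta>" using deg by (simp add: inc_def)
        finally show "(\<Sum>e\<in>inc u - ?B. 1 / (real N)\<^sup>2) \<le> \<Delta> / (real N)\<^sup>2"
          by (simp add: divide_right_mono)
      qed
      finally show "(\<Sum>e\<in>inc u - inc v. 1 / real N ^ card (mates v e))
          \<le> 300 / real (r ^ 3) + \<Delta> / (real (r ^ 3))\<^sup>2" by (simp add: N_def)
    qed simp
    finally show ?thesis by (simp add: A_def Inr uv)
  qed
  have cardT: "card (T j) \<le> 2 * \<Delta>" for j
  proof (cases j)
    case (Inl w)
    then show ?thesis using deg[of w] by (simp add: T_def inc_def)
  next
    case (Inr uv)
    obtain u v where uv: "uv = (u, v)" by fastforce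
    have "card (inc u \<union> inc v) \<le> card (inc u) + card (inc v)" by (rule card_Un_le)
    then show ?thesis using deg[of u] deg[of v] by (simp add: T_def Inr uv inc_def)
  qed
  have cardJ: "card {j \<in> J. e \<in> T j} \<le> 6 * \<Delta>" if "e \<in> E" for e
  proof -
    define Nb where "Nb z = {v. \<exists>e\<in>E. ends e = {z, v}}" for z
    have Nb: "finite (Nb z)" "card (Nb z) \<le> \<Delta>" for z
      unfolding Nb_def using card_neighbours_le[of E ends z] assms(1) two deg[of z] by fastforce+
    \<comment> \<open>Two vertex events, and at each end of \<open>e\<close> the pairs with a
      neighbour in either order: 2 + 2 * 2 \<Delta> \<le> 6 \<Delta>.\<close>
    let ?W = "(\<Union>z\<in>ends e. {z} \<times> Nb z \<union> Nb z \<times> {z})"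
    have finends: "finite (ends e)" using two[OF that] by (intro card_ge_0_finite) auto
    have P': "v \<in> Nb u \<and> u \<in> Nb v" if "(u, v) \<in> P" for u v
      using that by (auto simp: P_def Nb_def insert_commute)
    have "{j \<in> J. e \<in> T j} \<subseteq> Inl ` ends e \<union> Inr ` ?W"
    proof
      fix j assume j: "j \<in> {j \<in> J. e \<in> T j}"
      show "j \<in> Inl ` ends e \<union> Inr ` ?W"
      proof (cases j)
        case (Inl w)
        then show ?thesis using j by (auto simp: T_def inc_def edges_at_def)
      next
        case (Inr uv)
        obtain u v where uv: "uv = (u, v)" by fastforce
        then have "(u, v) \<in> P" "u \<in> ends e \<or> v \<in> ends e"
          using j Inr by (auto simp: J_def T_def inc_def edges_at_def)
        then have "(u, v) \<in> ?W" using P'[of u v] by blast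
        then show ?thesis unfolding Inr uv by (intro UnI2 imageI)
      qed
    qed
    then have "card {j \<in> J. e \<in> T j} \<le> card (Inl ` ends e \<union> Inr ` ?W)"
      using finends Nb(1) by (intro card_mono) auto
    also have "\<dots> = card (ends e) + card ?W"
      using finends Nb(1) by (subst card_Un_disjoint) (auto simp: card_image)
    also have "card ?W \<le> (\<Sum>z\<in>ends e. card ({z} \<times> Nb z \<union> Nb z \<times> {z}))"
      using finends by (rule card_UN_le)
    also have "\<dots> \<le> (\<Sum>z\<in>ends e. 2 * \<Delta>)"
    proof (rule sum_mono)
      fix z
      have "card ({z} \<times> Nb z \<union> Nb z \<times> {z}) \<le> card ({z} \<times> Nb z) + card (Nb z \<times> {z})" by (rule card_Un_le)
      also have "\<dots> \<le> 2 * \<Delta>" using Nb(2)[of z] by (simp add: card_cartesian_product)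
      finally show "card ({z} \<times> Nb z \<union> Nb z \<times> {z}) \<le> 2 * \<Delta>" .
    qed
    finally show ?thesis using two[OF that] \<Delta> by simp
  qed
  have "\<exists>\<omega>\<in>\<Omega>. \<forall>j\<in>J. \<omega> \<notin> A j"
  proof (rule lovasz_local_lemma[OF \<Omega>_def fin\<Omega> \<open>\<Omega> \<noteq> {}\<close> assms(1) _ det _ cardT cardJ prob])
    show "finite J" using finV finP by (simp add: J_def)
    show "T j \<subseteq> E" if "j \<in> J" for j using incE by (auto simp: T_def split: sum.splits)
    show "4 * p * real (2 * \<Delta>) * real (6 * \<Delta>) \<le> 1" using \<Delta> by (simp add: p_def power2_eq_square)
    have "1 \<le> (real \<Delta>)\<^sup>2" using \<Delta> by simp
    then have "1 < 24 * (real \<Delta>)\<^sup>2" by linarith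
    then show "2 * p < 1" using \<Delta> unfolding p_def by (simp add: divide_less_eq_1)
  qed (auto simp: p_def)
  then obtain \<omega> where \<omega>: "\<omega> \<in> \<Omega>" "\<And>j. j \<in> J \<Longrightarrow> \<omega> \<notin> A j" by blast
  define X where "X = {e \<in> E. \<omega> e = 0}"
  have incX: "edges_at ends X w = {e \<in> inc w. \<omega> e = 0}" for w by (auto simp: X_def inc_def edges_at_def)
  have vertex: "\<omega> \<notin> many w \<and> \<omega> \<notin> few w" if "w \<in> V" for w
    using \<omega>(2)[of "Inl w"] that by (auto simp: J_def A_def)
  have empty: "inc w = {}" if "w \<notin> V" for w using that by (auto simp: V_def inc_def edges_at_def)
  have "card (edges_at ends X w) \<le> 2 * r" for w
    using vertex[of w] empty[of w] \<omega>(1) unfolding incX many_def by (cases "w \<in> V") auto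
  moreover have "6 * (r div 48) \<le> card (edges_at ends X w)" if "\<Delta> < 4 * card (inc w)" for w
    using vertex[of w] empty[of w] \<omega>(1) that unfolding incX few_def by (cases "w \<in> V") auto
  moreover have "\<not> clash ends E c X u v" if "(u, v) \<in> P" for u v
  proof
    assume "clash ends E c X u v"
    then obtain Q where Q: "Q \<subseteq> inc u - inc v" "card Q = 5" "\<forall>e\<in>Q. \<forall>f\<in>mates v e. f \<in> X"
      unfolding clash_def inc_def[symmetric] mates_def[symmetric] by blast
    then have "\<forall>e\<in>Q. \<forall>f\<in>mates v e. \<omega> f = 0" by (auto simp: X_def)
    then have "\<omega> \<in> pat u v" using Q \<omega>(1) unfolding pat_def by blast
    then show False using \<omega>(2)[of "Inr (u, v)"] that by (auto simp: J_def A_def)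
  qed
  moreover have "X \<subseteq> E" by (auto simp: X_def)
  ultimately show ?thesis unfolding inc_def P_def by (intro exI[of _ X]) auto
qed

section \<open>Distinguishing high vertices of a multigraph\<close>

text \<open>Pairs joined by exactly one edge are distinguished: with two parallel edges in
  \<open>H\<close>, fewer than five of the six edges of \<open>H\<close> at \<open>u\<close> might
  avoid \<open>v\<close>.\<close>

lemma multigraph_distinguishing_coloring:
  fixes ends :: "'e \<Rightarrow> 'v set"
  assumes "finite E" and two: "\<And>e. e \<in> E \<Longrightarrow> card (ends e) = 2"
    and deg: "\<And>w. card (edges_at ends E w) \<le> \<Delta>" and "10 ^ 20 < \<Delta>"
    and mult: "\<And>v w. v \<noteq> w \<Longrightarrow> card {e \<in> E. ends e = {v, w}} \<le> 2"
  shows "\<exists>c :: 'e \<Rightarrow> nat. proper_on ends E c \<and> c ` E \<subseteq> {..<\<Delta> + 300} \<and>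
    (\<forall>u v. \<Delta> < 4 * card (edges_at ends E u) \<longrightarrow> \<Delta> < 4 * card (edges_at ends E v) \<longrightarrow>
       card {e \<in> E. ends e = {u, v}} = 1 \<longrightarrow> c ` edges_at ends E u \<noteq> c ` edges_at ends E v)"
proof -
  obtain c0 :: "'e \<Rightarrow> nat" where c0: "proper_on ends E c0" "c0 ` E \<subseteq> {..<\<Delta> + 2}"
    using vizing_multigraph[OF assms(1) two deg mult, of "{..<\<Delta> + 2}"] by auto
  obtain r where r: "10 ^ 5 \<le> r" "r ^ 4 \<le> \<Delta>" "\<Delta> < (r + 1) ^ 4"
    using fourth_root_bounds[OF assms(4)] by blast
  obtain X where X: "X \<subseteq> E" "\<And>w. card (edges_at ends X w) \<le> 2 * r"
    "\<And>w. \<Delta> < 4 * card (edges_at ends E w) \<Longrightarrow> 6 * (r div 48) \<le> card (edges_at ends X w)"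
    "\<And>u v. (\<exists>e\<in>E. ends e = {u, v}) \<Longrightarrow>
       card {e \<in> edges_at ends E u. c0 e \<notin> c0 ` edges_at ends E v} \<le> 300 \<Longrightarrow> \<not> clash ends E c0 X u v"
    using random_subset[OF assms(1) two deg c0(1) r] by blast
  \<comment> \<open>The lower bound 6 (r div 48) for degrees in \<open>X\<close> becomes six edges
    of \<open>H\<close>. The upper bound 2 r gives fewer than 97 full blocks, whence 291 = 3 *
    97.\<close>
  define q where "q = r div 48"
  have q: "0 < q" using r(1) by (simp add: q_def div_greater_zero_iff)
  have sub_mult: "card {e \<in> Y. ends e = {v, w}} \<le> 2" if "v \<noteq> w" "Y \<subseteq> E" for v w Y
  proof -
    have "card {e \<in> Y. ends e = {v, w}} \<le> card {e \<in> E. ends e = {v, w}}"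
      using that assms(1) by (intro card_mono) auto
    then show ?thesis using mult[OF that(1)] by linarith
  qed
  have "\<exists>H\<subseteq>X. \<forall>w. card (edges_at ends X w) div q \<le> card (edges_at ends H w) \<and>
      card (edges_at ends H w) \<le> 3 * (2 * r div q + 1)"
    using X(1,2) two q sub_mult assms(1) by (intro sparse_subgraph) (auto intro: finite_subset)
  then obtain H where H: "H \<subseteq> X"
    "\<And>w. card (edges_at ends X w) div q \<le> card (edges_at ends H w)"
    "\<And>w. card (edges_at ends H w) \<le> 3 * (2 * r div q + 1)" by blast
  have "100000 \<le> r" using r(1) by simp
  moreover have "r < 48 + 48 * q" using dividend_less_times_div[of 48 r] by (simp add: q_def)
  ultimately have "2 * r < 97 * q" by linarith
  then have "2 * r div q < 97" using q by (simp add: div_less_iff_less_mult)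
  then have "3 * (2 * r div q + 1) \<le> 291" by simp
  then have upper: "card (edges_at ends H w) \<le> 291" for w using H(3) le_trans by blast
  have lower: "6 \<le> card (edges_at ends H w)" if "\<Delta> < 4 * card (edges_at ends E w)" for w
  proof -
    have "6 * q \<le> card (edges_at ends X w)" using X(3)[OF that] by (simp add: q_def)
    then have "6 * q div q \<le> card (edges_at ends X w) div q" by (rule div_le_mono)
    then show ?thesis using H(2)[of w] q by simp
  qed
  have HE: "H \<subseteq> E" using H(1) X(1) by (rule subset_trans)
  then have finH: "finite H" using assms(1) by (rule finite_subset)
  \<comment> \<open>Degree 291 and multiplicity two call for 293 new colours, from \<Delta> + 2 to
    \<Delta> + 294.\<close>
  have "\<exists>h :: 'e \<Rightarrow> nat. proper_on ends H h \<and> h ` H \<subseteq> {\<Delta> + 2..<\<Delta> + 295}"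
    using finH two upper sub_mult[OF _ HE] HE by (intro vizing_multigraph[where d = 291 and \<mu> = 2]) auto
  then obtain h :: "'e \<Rightarrow> nat" where h: "proper_on ends H h" "h ` H \<subseteq> {\<Delta> + 2..<\<Delta> + 295}" by blast
  define c where "c e = (if e \<in> H then h e else c0 e)" for e
  have hge: "\<Delta> + 2 \<le> h e" if "e \<in> H" for e using h(2) that by auto
  have c0lt: "c0 e < \<Delta> + 2" if "e \<in> E" for e using c0(2) that by auto
  have proper: "proper_on ends E c"
    unfolding proper_on_def
  proof (intro ballI impI)
    fix e f assume *: "e \<in> E" "f \<in> E" "e \<noteq> f" "ends e \<inter> ends f \<noteq> {}"
    then have "c0 e \<noteq> c0 f" using c0(1) by (simp add: proper_on_def)
    moreover have "h e \<noteq> h f" if "e \<in> H" "f \<in> H" using h(1) * that by (simp add: proper_on_def)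
    moreover have "h e \<noteq> c0 f" if "e \<in> H" using hge[OF that] c0lt[OF *(2)] by linarith
    moreover have "c0 e \<noteq> h f" if "f \<in> H" using hge[OF that] c0lt[OF *(1)] by linarith
    ultimately show "c e \<noteq> c f" by (simp add: c_def)
  qed
  have range: "c ` E \<subseteq> {..<\<Delta> + 300}"
    using h(2) c0lt by (fastforce simp: c_def)
  have "c ` edges_at ends E u \<noteq> c ` edges_at ends E v"
    if big: "\<Delta> < 4 * card (edges_at ends E u)" and one: "card {e \<in> E. ends e = {u, v}} = 1" for u v
  proof
    assume eq: "c ` edges_at ends E u = c ` edges_at ends E v"
    obtain e0 where e0: "{e \<in> E. ends e = {u, v}} = {e0}" using one by (auto simp: card_1_singleton_iff)
    then have e0E: "e0 \<in> E" "ends e0 = {u, v}" by blast+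
    then have "u \<noteq> v" using two[of e0] by auto
    \<comment> \<open>New colours start at \<Delta> + 2, so the colour set of \<open>w\<close>
      reveals the old colours that survive there.\<close>
    have old: "c0 ` (edges_at ends E w - H) = {x \<in> c ` edges_at ends E w. x < \<Delta> + 2}" for w
      using hge c0lt by (auto simp: c_def edges_at_def image_iff) (metis leD)+
    have old_eq: "c0 ` (edges_at ends E u - H) = c0 ` (edges_at ends E v - H)"
      unfolding old eq ..
    \<comment> \<open>An edge at \<open>u\<close> that keeps its colour has this colour at
      \<open>v\<close> too. So these edges lie in \<open>H\<close>, and 291 \<le> 300 admits the
      pair.\<close>
    have "{e \<in> edges_at ends E u. c0 e \<notin> c0 ` edges_at ends E v} \<subseteq> edges_at ends H u"
    proof
      fix e assume e: "e \<in> {e \<in> edges_at ends E u. c0 e \<notin> c0 ` edges_at ends E v}"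
      then have "e \<in> H" using old_eq by blast
      then show "e \<in> edges_at ends H u" using e by (simp add: edges_at_def)
    qed
    then have "card {e \<in> edges_at ends E u. c0 e \<notin> c0 ` edges_at ends E v} \<le> card (edges_at ends H u)"
      using finH by (intro card_mono) auto
    then have "\<not> clash ends E c0 X u v" using X(4)[of u v] e0E upper[of u] by fastforce
    moreover have "clash ends E c0 X u v"
    proof -
      \<comment> \<open>Of the six edges of \<open>H\<close> at \<open>u\<close> only
        \<open>e0\<close> can reach \<open>v\<close>.\<close>
      have "edges_at ends H u \<inter> edges_at ends E v \<subseteq> {e0}"
      proof
        fix e assume e: "e \<in> edges_at ends H u \<inter> edges_at ends E v"
        then have "ends e = {u, v}"
          using two \<open>u \<noteq> v\<close> by (intro ends_eqI) (auto simp: edges_at_def)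
        then show "e \<in> {e0}" using e e0 by (auto simp: edges_at_def)
      qed
      then have "card (edges_at ends H u \<inter> edges_at ends E v) \<le> 1"
        using card_mono[of "{e0}"] by fastforce
      moreover have "card (edges_at ends H u - edges_at ends E v)
          = card (edges_at ends H u) - card (edges_at ends H u \<inter> edges_at ends E v)"
        using finH by (intro card_Diff_subset_Int) simp
      ultimately have "5 \<le> card (edges_at ends H u - edges_at ends E v)" using lower[OF big] by linarith
      then obtain Q where Q: "Q \<subseteq> edges_at ends H u - edges_at ends E v" "card Q = 5"
        by (metis obtain_subset_with_card_n)
      \<comment> \<open>Outside \<open>X\<close>, the edge \<open>f\<close> would keep its colour,
        which would then survive at \<open>u\<close> on some \<open>g\<close> outside
        \<open>H\<close>. Properness of \<open>c0\<close> forces g = e, although \<open>e\<close> is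
        in \<open>H\<close>.\<close>
      have "f \<in> X" if e: "e \<in> Q" and f: "f \<in> edges_at ends E v" "c0 f = c0 e" for e f
      proof (rule ccontr)
        assume "f \<notin> X"
        then have "c0 e \<in> c0 ` (edges_at ends E v - H)" using f H(1) by (metis DiffI imageI subsetD)
        then obtain g where g: "g \<in> edges_at ends E u" "g \<notin> H" "c0 g = c0 e" using old_eq by force
        have "e \<in> edges_at ends E u" "e \<in> H" using e Q(1) HE by (auto simp: edges_at_def)
        then show False using inj_onD[OF proper_on_inj[OF c0(1)] g(3,1)] g(2) by blast
      qed
      moreover have "Q \<subseteq> X" using Q(1) H(1) by (auto simp: edges_at_def)
      moreover have "Q \<subseteq> edges_at ends E u - edges_at ends E v" using Q(1) HE by (auto simp: edges_at_def)
      ultimately show ?thesis using Q(2) unfolding clash_def by (intro exI[of _ Q]) auto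
    qed
    ultimately show False ..
  qed
  then show ?thesis using proper range by blast
qed

subsection \<open>Recolouring edges between vertices of low degree\<close>

lemma simple_graph_edgeE:
  assumes "simple_graph V E" "e \<in> E" "x \<in> e"
  obtains y where "e = {x, y}" "x \<noteq> y"
  using assms unfolding simple_graph_def by (metis card_2_iff doubleton_eq_iff insertE singletonD)

lemma simple_graph_finite: "simple_graph V E \<Longrightarrow> finite E"
  unfolding simple_graph_def by (meson PowI finite_Pow_iff finite_subset subsetI)

lemma finite_incident_edges: "simple_graph V E \<Longrightarrow> finite (incident_edges E v)"
  by (auto simp: incident_edges_def dest: simple_graph_finite)

lemma degree_le_max_degree:
  assumes "simple_graph V E"
  shows "degree E v \<le> max_degree V E"
proof (cases "v \<in> V")
  case True
  then show ?thesis using assms by (auto simp: max_degree_def simple_graph_def intro!: Max_ge)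
next
  case False
  then have "incident_edges E v = {}" using assms by (auto simp: incident_edges_def simple_graph_def)
  then show ?thesis by (simp add: degree_def)
qed

lemma proper_edge_coloringD:
  "proper_edge_coloring E c \<Longrightarrow> e \<in> E \<Longrightarrow> f \<in> E \<Longrightarrow> x \<in> e \<Longrightarrow> x \<in> f \<Longrightarrow> c e = c f \<Longrightarrow> e = f"
  unfolding proper_edge_coloring_def by (metis disjoint_iff)

lemma card_color_set: "proper_edge_coloring E c \<Longrightarrow> card (color_set E c v) = degree E v"
  unfolding color_set_def degree_def
  by (rule card_image, rule inj_onI, rule proper_edge_coloringD[where x = v and c = c]) (auto simp: incident_edges_def)

lemma color_set_upd:
  assumes "proper_edge_coloring E c" "f \<in> E" "w \<in> f"
  shows "color_set E (c(f := \<alpha>)) w = insert \<alpha> (color_set E c w - {c f})"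
  using assms proper_edge_coloringD[OF assms(1) _ assms(2)]
  by (auto simp: color_set_def incident_edges_def image_iff)

lemma color_set_upd_other: "w \<notin> f \<Longrightarrow> color_set E (c(f := \<alpha>)) w = color_set E c w"
  unfolding color_set_def by (intro image_cong) (auto simp: incident_edges_def)

text \<open>In its use \<open>Z\<close> is the colour set of \<open>w\<close> without the edge to be
  recoloured and \<open>S y\<close> that of a neighbour, so these colours create a conflict. As
  \<open>\<alpha>\<close> is outside \<open>Z\<close>, it is determined by \<open>S y\<close>, and
  each edge at \<open>w\<close> accounts for at most one.\<close>

lemma card_completing_colors:
  assumes "simple_graph V E"
  shows "finite {\<alpha>. \<alpha> \<notin> Z \<and> (\<exists>y. {w, y} \<in> E \<and> insert \<alpha> Z = S y)}"
    and "card {\<alpha>. \<alpha> \<notin> Z \<and> (\<exists>y. {w, y} \<in> E \<and> insert \<alpha> Z = S y)} \<le> degree E w"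
proof -
  let ?A = "{\<alpha>. \<alpha> \<notin> Z \<and> (\<exists>y. {w, y} \<in> E \<and> insert \<alpha> Z = S y)}"
  have "\<forall>\<alpha>\<in>?A. \<exists>y. {w, y} \<in> E \<and> insert \<alpha> Z = S y" by blast
  from bchoice[OF this] obtain y where y: "\<And>\<alpha>. \<alpha> \<in> ?A \<Longrightarrow> {w, y \<alpha>} \<in> E \<and> insert \<alpha> Z = S (y \<alpha>)"
    by blast
  have inj: "inj_on (\<lambda>\<alpha>. {w, y \<alpha>}) ?A"
  proof (rule inj_onI)
    fix \<alpha> \<beta> assume *: "\<alpha> \<in> ?A" "\<beta> \<in> ?A" "{w, y \<alpha>} = {w, y \<beta>}"
    then have "y \<alpha> = y \<beta>" by (auto simp: doubleton_eq_iff)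
    then have "insert \<alpha> Z = insert \<beta> Z" using y[OF *(1)] y[OF *(2)] by simp
    moreover have "\<alpha> \<notin> Z" using *(1) by simp
    ultimately show "\<alpha> = \<beta>" by blast
  qed
  have sub: "(\<lambda>\<alpha>. {w, y \<alpha>}) ` ?A \<subseteq> incident_edges E w" using y by (auto simp: incident_edges_def)
  have fin: "finite (incident_edges E w)" by (rule finite_incident_edges[OF assms])
  show "finite ?A" using inj_on_finite[OF inj sub fin] .
  show "card ?A \<le> degree E w" using card_inj_on_le[OF inj sub fin] by (simp add: degree_def)
qed

definition low_degree :: "'a set set \<Rightarrow> nat \<Rightarrow> 'a \<Rightarrow> bool" where
  "low_degree E \<Delta> v \<longleftrightarrow> 4 * degree E v \<le> \<Delta>"

text \<open>No recolouring of an edge between low vertices settles a conflict here: recolouring the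
  edge itself affects both ends alike, and every adjacent edge has a high end.\<close>

definition lonely_edges :: "'a set set \<Rightarrow> nat \<Rightarrow> 'a set set" where
  "lonely_edges E \<Delta> = {e \<in> E. (\<forall>x\<in>e. low_degree E \<Delta> x) \<and>
     (\<forall>f\<in>E. f \<noteq> e \<longrightarrow> f \<inter> e \<noteq> {} \<longrightarrow> (\<exists>y\<in>f. \<not> low_degree E \<Delta> y))}"

lemma lonely_edges_disjoint:
  "e \<in> lonely_edges E \<Delta> \<Longrightarrow> f \<in> lonely_edges E \<Delta> \<Longrightarrow> x \<in> e \<Longrightarrow> x \<in> f \<Longrightarrow> e = f"
  unfolding lonely_edges_def by blast

definition conflicts :: "'a set set \<Rightarrow> ('a set \<Rightarrow> 'c) \<Rightarrow> 'a set set" where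
  "conflicts E c = {e \<in> E. \<forall>x\<in>e. \<forall>y\<in>e. color_set E c x = color_set E c y}"

text \<open>Only edges between low vertices get recoloured later, so lonely edges and edges between
  high vertices must be free of conflicts from the start.\<close>

definition nearly_avd :: "'a set set \<Rightarrow> nat \<Rightarrow> nat \<Rightarrow> ('a set \<Rightarrow> nat) \<Rightarrow> bool" where
  "nearly_avd E \<Delta> k c \<longleftrightarrow> proper_edge_coloring E c \<and> c ` E \<subseteq> {0..<k} \<and>
     (\<forall>e\<in>conflicts E c. e \<notin> lonely_edges E \<Delta> \<and> (\<exists>x\<in>e. low_degree E \<Delta> x))"

text \<open>Each edge meeting \<open>f\<close>, other than \<open>f\<close> itself, forbids at most one colour for being in
  conflict and one for properness, so fewer than \<open>k\<close> colours are forbidden for \<open>f\<close>.\<close>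

lemma recolor_low_edge:
  assumes G: "simple_graph V E" and c: "nearly_avd E \<Delta> k c" and "\<Delta> < k"
    and f: "f \<in> E" "\<And>x. x \<in> f \<Longrightarrow> low_degree E \<Delta> x"
    and e0: "e0 \<in> conflicts E c" "e0 \<noteq> f" "e0 \<inter> f \<noteq> {}" "\<And>x. x \<in> e0 \<Longrightarrow> low_degree E \<Delta> x"
  shows "\<exists>c'. nearly_avd E \<Delta> k c' \<and> conflicts E c' \<subset> conflicts E c"
proof -
  define S where "S w = color_set E c w" for w
  define Z where "Z w = S w - {c f}" for w
  define bad where "bad w = {\<alpha>. \<alpha> \<notin> Z w \<and> (\<exists>y. {w, y} \<in> E \<and> insert \<alpha> (Z w) = S y)}" for w
  have proper: "proper_edge_coloring E c" and range: "c ` E \<subseteq> {0..<k}"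
    using c by (auto simp: nearly_avd_def)
  obtain u x where ux: "f = {u, x}" "u \<noteq> x"
    using f(1) G by (metis card_2_iff simple_graph_def)
  have finS: "finite (S w)" for w
    using finite_incident_edges[OF G] by (simp add: S_def color_set_def)
  have cardbad: "finite (bad w)" "card (bad w) \<le> degree E w" for w
    unfolding bad_def by (rule card_completing_colors[OF G])+
  have card: "card (S w \<union> bad w) \<le> 2 * degree E w" for w
    using card_Un_le[of "S w" "bad w"] cardbad(2)[of w] card_color_set[OF proper, of w]
    by (simp add: S_def)
  have "card ((S u \<union> bad u) \<union> (S x \<union> bad x)) \<le> card (S u \<union> bad u) + card (S x \<union> bad x)"
    by (rule card_Un_le)
  \<comment> \<open>Twice the degree at each of two ends, hence the threshold
    \<open>\<Delta> / 4\<close> for low vertices.\<close>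
  also have "\<dots> \<le> \<Delta>"
    using card[of u] card[of x] f(2)[of u] f(2)[of x] ux by (simp add: low_degree_def)
  also have "\<dots> < card {0..<k}" using assms(3) by simp
  finally have "\<not> {0..<k} \<subseteq> (S u \<union> bad u) \<union> (S x \<union> bad x)"
    using finS cardbad(1) by (meson card_mono finite_UnI leD)
  then obtain \<alpha> where "\<alpha> \<in> {0..<k}" "\<alpha> \<notin> (S u \<union> bad u) \<union> (S x \<union> bad x)" by blast
  then have \<alpha>: "\<alpha> < k" "\<And>w. w \<in> f \<Longrightarrow> \<alpha> \<notin> S w" "\<And>w. w \<in> f \<Longrightarrow> \<alpha> \<notin> bad w"
    using ux by auto
  define c' where "c' = c(f := \<alpha>)"
  have S'in: "color_set E c' w = insert \<alpha> (Z w)" if "w \<in> f" for w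
    unfolding c'_def Z_def S_def by (rule color_set_upd[OF proper f(1) that])
  have S'out: "color_set E c' w = S w" if "w \<notin> f" for w
    unfolding c'_def S_def by (rule color_set_upd_other[OF that])
  have \<alpha>new: "\<alpha> \<noteq> c e" if "e \<in> E" "e \<inter> f \<noteq> {}" for e
    using \<alpha>(2) that by (fastforce simp: S_def color_set_def incident_edges_def)
  have proper': "proper_edge_coloring E c'"
    unfolding proper_edge_coloring_def
  proof (intro ballI impI)
    fix e g assume *: "e \<in> E" "g \<in> E" "e \<noteq> g \<and> e \<inter> g \<noteq> {}"
    then have "c e \<noteq> c g" using proper unfolding proper_edge_coloring_def by blast
    then show "c' e \<noteq> c' g" using \<alpha>new[of e] \<alpha>new[of g] * by (auto simp: c'_def)
  qed
  have resolved: "e \<notin> conflicts E c'" if e: "e \<in> E" "e \<noteq> f" "e \<inter> f \<noteq> {}" for e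
  proof
    assume conf: "e \<in> conflicts E c'"
    obtain w where w: "w \<in> e" "w \<in> f" using e by blast
    obtain y where y: "e = {w, y}" "w \<noteq> y" using simple_graph_edgeE[OF G e(1) w(1)] .
    obtain z where z: "f = {w, z}" "w \<noteq> z" using simple_graph_edgeE[OF G f(1) w(2)] .
    have "y \<notin> f" using y z e(2) by auto
    have "color_set E c' w = color_set E c' y" using conf y unfolding conflicts_def by blast
    then have "insert \<alpha> (Z w) = S y" using S'in[OF w(2)] S'out[OF \<open>y \<notin> f\<close>] by simp
    moreover have "\<alpha> \<notin> Z w" using \<alpha>(2)[OF w(2)] by (simp add: Z_def)
    ultimately have "\<alpha> \<in> bad w" using e(1) y by (auto simp: bad_def)
    then show False using \<alpha>(3)[OF w(2)] by blast
  qed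
  have sub: "conflicts E c' \<subseteq> conflicts E c"
  proof
    fix e assume e: "e \<in> conflicts E c'"
    then have eE: "e \<in> E" by (simp add: conflicts_def)
    consider "e = f" | "e \<inter> f = {}" using resolved[OF eE] e by blast
    then show "e \<in> conflicts E c"
    proof cases
      case 1
      \<comment> \<open>At both ends of \<open>f\<close> the colour \<open>c f\<close> is replaced
        by \<open>\<alpha>\<close>, so a conflict on \<open>f\<close> itself was there
        before.\<close>
      have cS: "c f \<in> S w" if "w \<in> f" for w
        using f(1) that by (auto simp: S_def color_set_def incident_edges_def)
      have "color_set E c' u = color_set E c' x" using e 1 ux(1) unfolding conflicts_def by blast
      then have "insert \<alpha> (Z u) = insert \<alpha> (Z x)" using S'in[of u] S'in[of x] ux(1) by simp
      moreover have "\<alpha> \<notin> Z u" "\<alpha> \<notin> Z x" using \<alpha>(2) ux by (auto simp: Z_def)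
      ultimately have "Z u = Z x" by (metis insert_ident)
      then have "S u = S x" using cS[of u] cS[of x] ux unfolding Z_def by (metis insertI1 insert_Diff insert_commute)
      then show ?thesis using 1 ux f(1) by (auto simp: conflicts_def S_def)
    next
      case 2
      then have same: "color_set E c' w = S w" if "w \<in> e" for w
        using S'out[of w] that by blast
      have "color_set E c' w = color_set E c' y" if "w \<in> e" "y \<in> e" for w y
        using e that unfolding conflicts_def by blast
      then have "S w = S y" if "w \<in> e" "y \<in> e" for w y
        using that same[OF that(1)] same[OF that(2)] by metis
      then show ?thesis using eE unfolding conflicts_def S_def by blast
    qed
  qed
  have "e0 \<in> E" using e0(1) by (simp add: conflicts_def)
  then have "e0 \<notin> conflicts E c'" using resolved e0 by blast
  then have "conflicts E c' \<subset> conflicts E c" using sub e0(1) by blast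
  moreover have "nearly_avd E \<Delta> k c'"
    using c sub proper' range \<alpha>(1) unfolding nearly_avd_def c'_def by (auto simp: image_subset_iff)
  ultimately show ?thesis by blast
qed

text \<open>Take a colouring with the fewest conflicts. The ends of a conflict have equal degrees,
  so both are low, and as the edge is not lonely, an adjacent edge between low vertices can be
  recoloured to remove the conflict.\<close>

lemma nearly_avd_imp_avd_colorable:
  assumes G: "simple_graph V E" and "nearly_avd E \<Delta> k c" and "\<Delta> < k"
  shows "avd_colorable E k"
proof -
  obtain c where c: "nearly_avd E \<Delta> k c"
    and min: "\<And>c'. nearly_avd E \<Delta> k c' \<Longrightarrow> card (conflicts E c) \<le> card (conflicts E c')"
    using ex_has_least_nat[of "nearly_avd E \<Delta> k" _ "\<lambda>c. card (conflicts E c)"] assms(2) by metis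
  have fin: "finite (conflicts E c)" using simple_graph_finite[OF G] by (simp add: conflicts_def)
  have proper: "proper_edge_coloring E c" using c by (simp add: nearly_avd_def)
  have "conflicts E c = {}"
  proof (rule ccontr)
    assume "conflicts E c \<noteq> {}"
    then obtain e where e: "e \<in> conflicts E c" by blast
    then have eE: "e \<in> E" by (simp add: conflicts_def)
    obtain x where x: "x \<in> e" "low_degree E \<Delta> x" and "e \<notin> lonely_edges E \<Delta>"
      using c e by (auto simp: nearly_avd_def)
    have low: "low_degree E \<Delta> y" if "y \<in> e" for y
    proof -
      have "color_set E c x = color_set E c y" using e x(1) that unfolding conflicts_def by blast
      then have "degree E x = degree E y" using card_color_set[OF proper] by metis
      then show ?thesis using x(2) by (simp add: low_degree_def)
    qed
    then obtain f where f: "f \<in> E" "f \<noteq> e" "f \<inter> e \<noteq> {}" "\<And>y. y \<in> f \<Longrightarrow> low_degree E \<Delta> y"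
      using \<open>e \<notin> lonely_edges E \<Delta>\<close> eE unfolding lonely_edges_def by blast
    have "\<exists>c'. nearly_avd E \<Delta> k c' \<and> conflicts E c' \<subset> conflicts E c"
      by (rule recolor_low_edge[OF G c assms(3) f(1,4) e]) (use f low in auto)
    then show False using min psubset_card_mono[OF fin] by (meson leD)
  qed
  have "color_set E c u \<noteq> color_set E c v" if uv: "{u, v} \<in> E" for u v
  proof
    assume "color_set E c u = color_set E c v"
    then have "color_set E c x = color_set E c y" if "x \<in> {u, v}" "y \<in> {u, v}" for x y
      using that by auto
    then have "{u, v} \<in> conflicts E c" using uv unfolding conflicts_def by blast
    then show False using \<open>conflicts E c = {}\<close> by blast
  qed
  then show ?thesis using c proper unfolding avd_colorable_def avd_coloring_def nearly_avd_def by blast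
qed

subsection \<open>Contracting lonely edges\<close>

text \<open>Contracting every lonely edge yields a multigraph of multiplicity at most two. In a proper
  colouring of it, the two ends of a lonely edge see disjoint sets of colours.\<close>

definition merge_class :: "'a set set \<Rightarrow> nat \<Rightarrow> 'a \<Rightarrow> 'a set" where
  "merge_class E \<Delta> x = insert x (\<Union>{e \<in> lonely_edges E \<Delta>. x \<in> e})"

text \<open>Lonely edges are pairwise disjoint, so the union has a single member. The contracted
  vertices are thus the lonely edges and the singletons of all other vertices.\<close>

lemma merge_class_lonely:
  assumes "e \<in> lonely_edges E \<Delta>" "x \<in> e"
  shows "merge_class E \<Delta> x = e"
proof -
  have "{f \<in> lonely_edges E \<Delta>. x \<in> f} = {e}" using assms lonely_edges_disjoint[of e E \<Delta> _ x] by blast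
  then show ?thesis using assms by (auto simp: merge_class_def)
qed

lemma merge_class_single: "x \<notin> \<Union>(lonely_edges E \<Delta>) \<Longrightarrow> merge_class E \<Delta> x = {x}"
  by (auto simp: merge_class_def)

lemma merge_class_self: "x \<in> merge_class E \<Delta> x"
  by (simp add: merge_class_def)

lemma merge_class_cases:
  obtains "merge_class E \<Delta> x = {x}" | "merge_class E \<Delta> x \<in> lonely_edges E \<Delta>"
  using merge_class_lonely merge_class_single by (metis UnionE)

lemma lonely_edges_subset: "lonely_edges E \<Delta> \<subseteq> E"
  by (auto simp: lonely_edges_def)

lemma lonely_edges_low: "e \<in> lonely_edges E \<Delta> \<Longrightarrow> x \<in> e \<Longrightarrow> low_degree E \<Delta> x"
  by (auto simp: lonely_edges_def)

lemma merge_class_high: "\<not> low_degree E \<Delta> x \<Longrightarrow> merge_class E \<Delta> x = {x}"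
  by (rule merge_class_single) (auto dest: lonely_edges_low)

text \<open>A further edge at a lonely edge has a high end, and high vertices are not contracted. So
  no edge joins two contracted pairs, which keeps the multiplicity at two rather than four.\<close>

lemma merge_class_other_end:
  assumes "{x, y} \<in> E - lonely_edges E \<Delta>" "merge_class E \<Delta> x \<noteq> {x}"
  shows "merge_class E \<Delta> y = {y}"
proof -
  obtain p where p: "p \<in> lonely_edges E \<Delta>" "x \<in> p" 
    using assms(2) merge_class_single[of x E \<Delta>] by blast
  have "{x, y} \<noteq> p" using p(1) assms(1) by blast
  moreover have "\<forall>f\<in>E. f \<noteq> p \<longrightarrow> f \<inter> p \<noteq> {} \<longrightarrow> (\<exists>z\<in>f. \<not> low_degree E \<Delta> z)"
    using p(1) by (simp add: lonely_edges_def)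
  ultimately have "\<exists>z\<in>{x, y}. \<not> low_degree E \<Delta> z" using assms(1) p(2) by auto
  then have "\<not> low_degree E \<Delta> y" using lonely_edges_low[OF p] by simp
  then show ?thesis by (rule merge_class_high)
qed

lemma card_merge_class:
  assumes "simple_graph V E"
  shows "finite (merge_class E \<Delta> x)" "card (merge_class E \<Delta> x) \<le> 2"
proof -
  have "finite (merge_class E \<Delta> x) \<and> card (merge_class E \<Delta> x) \<le> 2"
  proof (cases rule: merge_class_cases[of E \<Delta> x])
    case 2
    then have "merge_class E \<Delta> x \<in> E" using lonely_edges_subset by blast
    then have "card (merge_class E \<Delta> x) = 2" using assms by (simp add: simple_graph_def)
    then show ?thesis by (simp add: card_ge_0_finite)
  qed simp
  then show "finite (merge_class E \<Delta> x)" "card (merge_class E \<Delta> x) \<le> 2" by blast+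
qed

text \<open>No loops arise: distinct vertices with a common class are the two ends of one lonely
  edge, and the graph is simple.\<close>

lemma card_merged_ends:
  assumes G: "simple_graph V E" and e: "e \<in> E - lonely_edges E \<Delta>"
  shows "card (merge_class E \<Delta> ` e) = 2"
proof -
  have ce: "card e = 2" using G e by (auto simp: simple_graph_def)
  have "inj_on (merge_class E \<Delta>) e"
  proof (rule inj_onI, rule ccontr)
    fix x y assume xy: "x \<in> e" "y \<in> e" "merge_class E \<Delta> x = merge_class E \<Delta> y" "x \<noteq> y"
    have exy: "e = {x, y}" using ends_eqI[of "\<lambda>e. e" e x y] ce xy by simp
    have y: "y \<in> merge_class E \<Delta> x" using xy(3) merge_class_self by metis
    show False
    proof (cases rule: merge_class_cases[of E \<Delta> x])
      case 1
      then show False using y xy(4) by simp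
    next
      case 2
      have "merge_class E \<Delta> x \<in> E" using 2 lonely_edges_subset by blast
      then have "card (merge_class E \<Delta> x) = 2" using G by (simp add: simple_graph_def)
      then have "merge_class E \<Delta> x = {x, y}"
        using ends_eqI[of "\<lambda>e. e" "merge_class E \<Delta> x" x y] y xy(4) merge_class_self by metis
      then show False using 2 e exy by simp
    qed
  qed
  then show ?thesis using ce by (simp add: card_image)
qed

lemma merged_degree_le:
  assumes G: "simple_graph V E" and \<Delta>: "max_degree V E \<le> \<Delta>"
  shows "card (edges_at ((`) (merge_class E \<Delta>)) (E - lonely_edges E \<Delta>) W) \<le> \<Delta>" (is "card ?A \<le> _")
proof (cases "?A = {}")
  case False
  have fin: "finite (incident_edges E x)" for x by (rule finite_incident_edges[OF G])
  obtain z where z: "W = merge_class E \<Delta> z" using False by (auto simp: edges_at_def)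
  have sub: "?A \<subseteq> (\<Union>x\<in>W. incident_edges E x)"
    using merge_class_self by (fastforce simp: edges_at_def incident_edges_def)
  have finW: "finite W" using card_merge_class[OF G] z by simp
  have "card ?A \<le> card (\<Union>x\<in>W. incident_edges E x)"
    using sub fin finW by (intro card_mono) auto
  also have "\<dots> \<le> (\<Sum>x\<in>W. degree E x)" unfolding degree_def by (rule card_UN_le[OF finW])
  also have "\<dots> \<le> \<Delta>"
  proof (cases rule: merge_class_cases[of E \<Delta> z])
    case 1
    then show ?thesis using degree_le_max_degree[OF G, of z] \<Delta> z by simp
  next
    case 2
    have "4 * degree E x \<le> \<Delta>" if "x \<in> W" for x
      using lonely_edges_low[OF 2] that z by (simp add: low_degree_def)
    then have "(\<Sum>x\<in>W. 4 * degree E x) \<le> (\<Sum>x\<in>W. \<Delta>)" by (rule sum_mono)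
    also have "\<dots> = card W * \<Delta>" by simp
    also have "\<dots> \<le> 2 * \<Delta>" using card_merge_class[OF G] z by simp
    finally have "4 * (\<Sum>x\<in>W. degree E x) \<le> 2 * \<Delta>" by (simp add: sum_distrib_left)
    then show ?thesis by linarith
  qed
  finally show ?thesis .
qed simp

text \<open>One of the two classes is a singleton, so an edge is determined by its end in the other
  one, which has at most two members.\<close>

lemma merged_multiplicity_le:
  assumes G: "simple_graph V E" and "A \<noteq> B"
  shows "card {e \<in> E - lonely_edges E \<Delta>. merge_class E \<Delta> ` e = {A, B}} \<le> 2"
proof -
  let ?m = "merge_class E \<Delta>"
  have one: "card {e \<in> E - lonely_edges E \<Delta>. ?m ` e = {?m x, {y}}} \<le> 2" if "?m x \<noteq> {y}" for x y
  proof -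
    have "{e \<in> E - lonely_edges E \<Delta>. ?m ` e = {?m x, {y}}} \<subseteq> (\<lambda>z. {z, y}) ` ?m x"
    proof
      fix e assume e: "e \<in> {e \<in> E - lonely_edges E \<Delta>. ?m ` e = {?m x, {y}}}"
      then have im: "?m ` e = {?m x, {y}}" by blast
      then obtain w where w: "w \<in> e" "?m w = {y}" by (metis imageE insertI1 insertI2)
      obtain z where z: "z \<in> e" "?m z = ?m x" using im by (metis imageE insertI1)
      have wy: "w = y" using w(2) merge_class_self[of w E \<Delta>] by simp
      have "z \<noteq> w" using z w that by metis
      have "card e = 2" using e G by (auto simp: simple_graph_def)
      then have "e = {z, y}" using ends_eqI[of "\<lambda>e. e" e z w] z w wy \<open>z \<noteq> w\<close> by simp
      moreover have "z \<in> ?m x" using z(2) merge_class_self by metis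
      ultimately show "e \<in> (\<lambda>z. {z, y}) ` ?m x" by blast
    qed
    then have "card {e \<in> E - lonely_edges E \<Delta>. ?m ` e = {?m x, {y}}} \<le> card ((\<lambda>z. {z, y}) ` ?m x)"
      using card_merge_class[OF G] by (intro card_mono) auto
    also have "\<dots> \<le> card (?m x)" using card_merge_class[OF G] by (intro card_image_le)
    also have "\<dots> \<le> 2" by (rule card_merge_class[OF G])
    finally show ?thesis .
  qed
  show ?thesis
  proof (cases "{e \<in> E - lonely_edges E \<Delta>. ?m ` e = {A, B}} = {}")
    case False
    then obtain e where e: "e \<in> E - lonely_edges E \<Delta>" "?m ` e = {A, B}" by blast
    obtain x where x: "x \<in> e" "?m x = A" using e(2) by (metis imageE insertI1)
    obtain y where y: "e = {x, y}" "x \<noteq> y" using simple_graph_edgeE[OF G _ x(1)] e(1) by blast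
    have "?m y = B" using e(2) x(2) y(1) assms(2) by (auto simp: doubleton_eq_iff)
    show ?thesis
    proof (cases "?m x = {x}")
      case True
      then show ?thesis using one[of y x] x(2) \<open>?m y = B\<close> assms(2) by (simp add: insert_commute)
    next
      case False
      then have "?m y = {y}" using merge_class_other_end[of x y E \<Delta>] e(1) y(1) by simp
      then show ?thesis using one[of x y] x(2) \<open>?m y = B\<close> assms(2) by simp
    qed
  qed (simp only: card.empty)
qed

lemma edges_at_merge_high:
  assumes "\<not> low_degree E \<Delta> u"
  shows "edges_at ((`) (merge_class E \<Delta>)) (E - lonely_edges E \<Delta>) {u} = incident_edges E u"
proof (intro set_eqI iffI)
  fix e assume "e \<in> edges_at ((`) (merge_class E \<Delta>)) (E - lonely_edges E \<Delta>) {u}"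
  then obtain z where "e \<in> E" "z \<in> e" "merge_class E \<Delta> z = {u}" by (auto simp: edges_at_def)
  then show "e \<in> incident_edges E u"
    using merge_class_self[of z E \<Delta>] by (simp add: incident_edges_def)
next
  fix e assume e: "e \<in> incident_edges E u"
  then have "e \<notin> lonely_edges E \<Delta>" using assms lonely_edges_low[of e E \<Delta> u] by (auto simp: incident_edges_def)
  then show "e \<in> edges_at ((`) (merge_class E \<Delta>)) (E - lonely_edges E \<Delta>) {u}"
    using e merge_class_high[OF assms] by (auto simp: edges_at_def incident_edges_def image_iff)
qed

lemma nearly_avd_exists:
  assumes G: "simple_graph V E" and iso: "\<forall>e\<in>E. \<not> isolated_edge E e"
    and \<Delta>: "max_degree V E \<le> \<Delta>" "10 ^ 20 < \<Delta>"
  shows "\<exists>c. nearly_avd E \<Delta> (\<Delta> + 300) c"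
proof -
  let ?m = "merge_class E \<Delta>" and ?P = "lonely_edges E \<Delta>"
  let ?ends = "(`) (merge_class E \<Delta>)" and ?E = "E - lonely_edges E \<Delta>"
  have finE: "finite E" by (rule simple_graph_finite[OF G])
  have "\<exists>c :: 'a set \<Rightarrow> nat. proper_on ?ends ?E c \<and> c ` ?E \<subseteq> {..<\<Delta> + 300} \<and>
    (\<forall>u v. \<Delta> < 4 * card (edges_at ?ends ?E u) \<longrightarrow> \<Delta> < 4 * card (edges_at ?ends ?E v) \<longrightarrow>
       card {e \<in> ?E. ?ends e = {u, v}} = 1 \<longrightarrow> c ` edges_at ?ends ?E u \<noteq> c ` edges_at ?ends ?E v)"
    by (rule multigraph_distinguishing_coloring)
      (use finE card_merged_ends[OF G] merged_degree_le[OF G \<Delta>(1)] \<Delta>(2) merged_multiplicity_le[OF G] in auto)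
  then obtain c1 :: "'a set \<Rightarrow> nat" where c1: "proper_on ?ends ?E c1" "c1 ` ?E \<subseteq> {..<\<Delta> + 300}"
    and dist: "\<And>u v. \<Delta> < 4 * card (edges_at ?ends ?E u) \<Longrightarrow> \<Delta> < 4 * card (edges_at ?ends ?E v) \<Longrightarrow>
       card {e \<in> ?E. ?ends e = {u, v}} = 1 \<Longrightarrow> c1 ` edges_at ?ends ?E u \<noteq> c1 ` edges_at ?ends ?E v"
    by blast
  \<comment> \<open>Contracted vertices have degree at most \<open>\<Delta>\<close>, so a colour
    remains for each lonely edge when it is expanded again.\<close>
  have "\<exists>a<\<Delta> + 300. a \<notin> c1 ` edges_at ?ends ?E W" for W
  proof -
    have "card (c1 ` edges_at ?ends ?E W) \<le> card (edges_at ?ends ?E W)"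
      using finE by (intro card_image_le) simp
    also have "\<dots> < card {..<\<Delta> + 300}" using merged_degree_le[OF G \<Delta>(1), of W] by simp
    finally have "\<not> {..<\<Delta> + 300} \<subseteq> c1 ` edges_at ?ends ?E W"
      using finE by (metis card_mono finite_Diff finite_edges_at finite_imageI leD)
    then show ?thesis by blast
  qed
  then obtain g where g: "\<And>W. g W < \<Delta> + 300" "\<And>W. g W \<notin> c1 ` edges_at ?ends ?E W" by metis
  define c where "c e = (if e \<in> ?P then g e else c1 e)" for e
  have at_class: "f \<in> edges_at ?ends ?E (?m x)" if "f \<in> E" "f \<notin> ?P" "x \<in> f" for f x
    using that by (auto simp: edges_at_def)
  have same_class: "f = f'" if "f \<in> E" "f \<notin> ?P" "f' \<in> E" "f' \<notin> ?P" "x \<in> f" "x' \<in> f'" "?m x = ?m x'" "c f = c f'"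
    for f f' x x'
  proof -
    have "f \<in> edges_at ?ends ?E (?m x)" "f' \<in> edges_at ?ends ?E (?m x)"
      using at_class that by metis+
    moreover have "c1 f = c1 f'" using that by (simp add: c_def)
    ultimately show ?thesis using inj_onD[OF proper_on_inj[OF c1(1)]] by blast
  qed
  have fresh: "c p \<noteq> c f" if "p \<in> ?P" "f \<in> E" "f \<notin> ?P" "x \<in> p" "x \<in> f" for p f x
  proof -
    have "f \<in> edges_at ?ends ?E p" using at_class[of f x] merge_class_lonely[of p E \<Delta> x] that by simp
    then have "c1 f \<in> c1 ` edges_at ?ends ?E p" by blast
    then have "g p \<noteq> c1 f" using g(2)[of p] by metis
    then show ?thesis using that by (simp add: c_def)
  qed
  have proper: "proper_edge_coloring E c"
    unfolding proper_edge_coloring_def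
  proof (intro ballI impI)
    fix e f assume ef: "e \<in> E" "f \<in> E" "e \<noteq> f \<and> e \<inter> f \<noteq> {}"
    then obtain x where x: "x \<in> e" "x \<in> f" by blast
    show "c e \<noteq> c f"
    proof (cases "e \<in> ?P"; cases "f \<in> ?P")
      assume "e \<in> ?P" "f \<in> ?P"
      then show ?thesis using lonely_edges_disjoint[of e E \<Delta> f x] x ef by blast
    next
      assume "e \<in> ?P" "f \<notin> ?P"
      then show ?thesis using fresh ef x by blast
    next
      assume "e \<notin> ?P" "f \<in> ?P"
      then show ?thesis using fresh[of f e x] ef x by metis
    next
      assume "e \<notin> ?P" "f \<notin> ?P"
      then show ?thesis using same_class[of e f x x] ef x by blast
    qed
  qed
  have range: "c ` E \<subseteq> {0..<\<Delta> + 300}" using c1(2) g(1) by (auto simp: c_def)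
  have "e \<notin> ?P \<and> (\<exists>x\<in>e. low_degree E \<Delta> x)" if conf: "e \<in> conflicts E c" for e
  proof
    have eE: "e \<in> E" using conf by (simp add: conflicts_def)
    show "e \<notin> ?P"
    proof
      assume p: "e \<in> ?P"
      \<comment> \<open>As \<open>e\<close> is not isolated, some other edge meets it. Its colour
        would also occur at the far end of \<open>e\<close>, but all edges leaving \<open>e\<close>
        meet in one contracted vertex and have distinct colours.\<close>
      obtain f where f: "f \<in> E" "f \<inter> e \<noteq> {}" "f \<noteq> e" using iso eE unfolding isolated_edge_def by blast
      obtain u where u: "u \<in> f" "u \<in> e" using f(2) by (meson disjoint_iff)
      obtain v where v: "e = {u, v}" "u \<noteq> v" using simple_graph_edgeE[OF G eE u(2)] .
      have fP: "f \<notin> ?P" using lonely_edges_disjoint[of e E \<Delta> f u] p u f(3) by blast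
      have "c f \<in> color_set E c u" using f u by (auto simp: color_set_def incident_edges_def)
      moreover have "color_set E c u = color_set E c v" using conf v(1) unfolding conflicts_def by blast
      ultimately obtain h where h: "h \<in> E" "v \<in> h" "c h = c f" by (auto simp: color_set_def incident_edges_def)
      have "h \<noteq> e" using fresh[OF p f(1) fP u(2,1)] h(3) by metis
      then have hP: "h \<notin> ?P" using lonely_edges_disjoint[of e E \<Delta> h v] p h(2) v by blast
      have "?m u = ?m v" using merge_class_lonely[OF p] v(1) by simp
      then have "f = h" using same_class[OF f(1) fP h(1) hP u(1) h(2)] h(3) by simp
      then have "{u, v} \<subseteq> f" using u h(2) by simp
      moreover have "card f = 2" using f(1) G by (auto simp: simple_graph_def)
      ultimately have "f = {u, v}" using ends_eqI[of "\<lambda>e. e" f u v] v(2) by simp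
      then show False using f(3) v(1) by simp
    qed
    show "\<exists>x\<in>e. low_degree E \<Delta> x"
    proof (rule ccontr)
      assume "\<not> ?thesis"
      then have high: "\<not> low_degree E \<Delta> x" if "x \<in> e" for x using that by blast
      obtain u v where uv: "e = {u, v}" "u \<noteq> v" using eE G by (metis card_2_iff simple_graph_def)
      have deg: "\<Delta> < 4 * card (edges_at ?ends ?E {x})" if "x \<in> e" for x
        using high[OF that] edges_at_merge_high[OF high[OF that]] by (simp add: low_degree_def degree_def)
      have img: "c1 ` edges_at ?ends ?E {x} = color_set E c x" if "x \<in> e" for x
      proof -
        have "c f = c1 f" if "f \<in> incident_edges E x" for f
          using that high[OF \<open>x \<in> e\<close>] lonely_edges_low[of f E \<Delta> x] by (auto simp: c_def incident_edges_def)
        then show ?thesis unfolding edges_at_merge_high[OF high[OF that]] color_set_def by (intro image_cong) auto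
      qed
      \<comment> \<open>Both ends are high and hence uncontracted, so \<open>e\<close> stays without
        parallel edges and \<open>c1\<close> separates its ends.\<close>
      have "{f \<in> ?E. ?m ` f = {{u}, {v}}} = {e}"
      proof (intro set_eqI iffI)
        fix f assume f: "f \<in> {f \<in> ?E. ?m ` f = {{u}, {v}}}"
        have "{u} \<in> ?m ` f" "{v} \<in> ?m ` f" using f by auto
        then have "u \<in> f" "v \<in> f" using merge_class_self by (metis imageE singletonD)+
        moreover have "card f = 2" using f G by (auto simp: simple_graph_def)
        ultimately show "f \<in> {e}" using ends_eqI[of "\<lambda>e. e" f u v] uv by simp
      next
        fix f assume "f \<in> {e}"
        then have "f = e" by simp
        moreover have "e \<notin> ?P" using high[of u] lonely_edges_low[of e E \<Delta> u] uv by blast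
        moreover have "?m ` e = {{u}, {v}}" 
          using merge_class_high[OF high[of u]] merge_class_high[OF high[of v]] uv by simp
        ultimately show "f \<in> {f \<in> ?E. ?m ` f = {{u}, {v}}}" using eE by blast
      qed
      then have "card {f \<in> ?E. ?m ` f = {{u}, {v}}} = 1" by simp
      then have "color_set E c u \<noteq> color_set E c v"
        using dist[of "{u}" "{v}"] deg[of u] deg[of v] img[of u] img[of v] uv(1) by simp
      then show False using conf uv(1) unfolding conflicts_def by blast
    qed
  qed
  then show ?thesis using proper range unfolding nearly_avd_def by blast
qed

theorem theorem1:
  fixes V :: "'a set" and E :: "'a set set"
  assumes "simple_graph V E"
    and "\<forall>e\<in>E. \<not> isolated_edge E e"
    and "max_degree V E > 10 ^ 20"
  shows "avd_colorable E (max_degree V E + 300)"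
proof -
  obtain c where c: "nearly_avd E (max_degree V E) (max_degree V E + 300) c"
    using nearly_avd_exists[OF assms(1,2) order_refl assms(3)] by blast
  show ?thesis by (rule nearly_avd_imp_avd_colorable[OF assms(1) c]) simp
qed

end
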